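(* Let $p$ be a prime, $p>3$, and let $a,b\in\mathbb{Z}$ with $ab\not\equiv 0\pmod p$ and $a\not\equiv b\pmod p$. Then modulo $p$: \[ \sum_{k=0}^{p-1}C_{2k}\,\frac{(a-b)^{2k}}{(-64ab)^k}\equiv \begin{cases} \frac{(ab)^{\frac{p-1}{4}}}{2(a-b)}\left((3a+b)\left(\frac{b}{p}\right)-(3b+a)\left(\frac{a}{p}\right)\right), & p\equiv 1\pmod 4,\\[4pt] \frac{(ab)^{\frac{p+1}{4}}}{2(b-a)}\left(\frac{3a+b}{a}\left(\frac{b}{p}\right)-\frac{3b+a}{b}\left(\frac{a}{p}\right)\right), & p\equiv 3\pmod 4, \end{cases} \] \[ \sum_{k=0}^{p-1}\binom{4k}{2k}\frac{(a+b)^{2k}}{(64ab)^k}\equiv \begin{cases} \frac{\left(\frac{2}{p}\right)(ab)^{\frac{p-1}{4}}}{4(a-b)}\left((3a-b)\left(\frac{b}{p}\right)-(3b-a)\left(\frac{a}{p}\right)\right), & p\equiv 1\pmod 4,\\[4pt] \frac{\left(\frac{2}{p}\right)(ab)^{\frac{p+1}{4}}}{4(b-a)}\left(\frac{3a-b}{a}\left(\frac{b}{p}\right)-\frac{3b-a}{b}\left(\frac{a}{p}\right)\right), & p\equiv 3\pmod 4. \end{cases} \]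
   Context: $C_n=\frac{1}{n+1}\binom{2n}{n}$ are the Catalan numbers; $\left(\frac{\cdot}{p}\right)$ is the Legendre symbol. Congruences between rationals with denominators prime to $p$ are in the usual sense. *)

theory Defs
  imports "HOL-Number_Theory.Number_Theory"
begin

definition catalan :: "nat \<Rightarrow> rat" where
  "catalan n = 1 / of_nat (n + 1) * of_nat ((2 * n) choose n)"

(* quotient_of returns the reduced fraction with positive denominator. *)
definition denom_prime_to :: "nat \<Rightarrow> rat \<Rightarrow> bool" where
  "denom_prime_to m x \<longleftrightarrow> coprime (snd (quotient_of x)) (int m)"

(* A false statement, rather than an unspecified one, if x or y has a denominator
   not prime to m. *)
definition rat_cong :: "nat \<Rightarrow> rat \<Rightarrow> rat \<Rightarrow> bool" where
  "rat_cong m x y \<longleftrightarrow>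
     denom_prime_to m x \<and> denom_prime_to m y \<and> int m dvd fst (quotient_of (x - y))"

lemma rat_cong_of_int_iff: "rat_cong m (of_int x) (of_int y) \<longleftrightarrow> [x = y] (mod int m)"
  by (simp add: rat_cong_def denom_prime_to_def cong_iff_dvd_diff flip: of_int_diff)

end

theory Submission
  imports Defs
begin

text \<open>
  Write \<open>p = 2m + 1\<close>. Modulo \<open>p\<close> the central binomial coefficient of index \<open>n < p\<close> is \<open>(-4)\<^sup>n\<close>
  times the coefficient of \<open>x\<^sup>n\<close> in \<open>(1 + x)\<^bsup>m\<^esup>\<close>, the Catalan number of index \<open>n < p - 1\<close> is
  \<open>2 (-4)\<^sup>n\<close> times the coefficient of \<open>x\<^bsup>n+1\<^esup>\<close> in \<open>(1 + x)\<^bsup>m+1\<^esup>\<close>, and shifting \<open>n\<close> by \<open>p\<close>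
  doubles both. Hence, with \<open>y = (a + b)\<^sup>2 / (4ab)\<close>, both sums reduce to the even and odd parts of
  powers of \<open>1 + \<surd>y\<close> (for the Catalan sum \<open>b\<close> is replaced by \<open>-b\<close>).
  Let \<open>s = \<surd>(ab)\<close>. Then \<open>2ab \<cdot> a (1 + \<surd>y) = s (a + s)\<^sup>2\<close>, so the power \<open>m + 1\<close> of the left side
  contains the factor \<open>(a + s)\<^bsup>p+1\<^esup>\<close>, which the Frobenius map evaluates.
  Computing with pairs of integers, where \<open>(u, v)\<close> stands for \<open>u + v \<surd>t\<close>, avoids a case
  distinction on whether \<open>ab\<close> is a square modulo \<open>p\<close>.
\<close>

subsection \<open>Even and odd parts of powers of a quadratic surd\<close>

text \<open>Together with \<open>odd_part\<close> this splits a power of a surd: (1 + sqrt y)^n =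
  \<open>even_part n y\<close> + sqrt y * \<open>odd_part n y\<close>. The generous bound
  \<open>n\<close> only adds vanishing binomials.\<close>

definition even_part :: "nat \<Rightarrow> int \<Rightarrow> int" where
  "even_part n y = (\<Sum>k\<le>n. int (n choose (2 * k)) * y ^ k)"

definition odd_part :: "nat \<Rightarrow> int \<Rightarrow> int" where
  "odd_part n y = (\<Sum>k\<le>n. int (n choose (2 * k + 1)) * y ^ k)"

lemma even_part_upto:
  assumes "n \<le> 2 * N + 1"
  shows "even_part n y = (\<Sum>k\<le>N. int (n choose (2 * k)) * y ^ k)"
proof -
  \<comment> \<open>Either of \<open>n\<close> and \<open>N\<close> may be the larger, so both sums
    are compared with the one over the union of the ranges.\<close>
  have "even_part n y = (\<Sum>k\<in>{..n} \<union> {..N}. int (n choose (2 * k)) * y ^ k)"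
    unfolding even_part_def by (rule sum.mono_neutral_left) auto
  also have "\<dots> = (\<Sum>k\<le>N. int (n choose (2 * k)) * y ^ k)"
    using assms by (intro sum.mono_neutral_right) auto
  finally show ?thesis .
qed

lemma odd_part_upto:
  assumes "n \<le> 2 * N"
  shows "odd_part n y = (\<Sum>k<N. int (n choose (2 * k + 1)) * y ^ k)"
proof -
  have "odd_part n y = (\<Sum>k\<in>{..n} \<union> {..<N}. int (n choose (2 * k + 1)) * y ^ k)"
    unfolding odd_part_def by (rule sum.mono_neutral_left) auto
  also have "\<dots> = (\<Sum>k<N. int (n choose (2 * k + 1)) * y ^ k)"
    using assms by (intro sum.mono_neutral_right) auto
  finally show ?thesis .
qed

text \<open>Multiplication by 1 + sqrt y sends u + v sqrt y to (u + y v) + (u + v) sqrt y; on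
  coefficients this is Pascal's rule.\<close>

lemma even_part_Suc: "even_part (Suc n) y = even_part n y + y * odd_part n y"
proof -
  have "even_part (Suc n) y =
      1 + (\<Sum>k\<le>n. int (Suc n choose (2 * k + 2)) * y ^ Suc k)"
    unfolding even_part_def by (subst sum.atMost_Suc_shift) simp
  also have "\<dots> = 1 + (\<Sum>k\<le>n. int (n choose (2 * k + 2)) * y ^ Suc k) + y * odd_part n y"
    by (simp add: odd_part_def algebra_simps sum.distrib sum_distrib_left)
  \<comment> \<open>The 1 is the term k = 0 put back in place; the new top index
    \<open>Suc n\<close> contributes zero.\<close>
  also have "1 + (\<Sum>k\<le>n. int (n choose (2 * k + 2)) * y ^ Suc k) =
      (\<Sum>k\<le>Suc n. int (n choose (2 * k)) * y ^ k)"
    by (subst sum.atMost_Suc_shift) simp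
  also have "\<dots> = even_part n y"
    by (simp add: even_part_def)
  finally show ?thesis .
qed

lemma odd_part_Suc: "odd_part (Suc n) y = even_part n y + odd_part n y"
  \<comment> \<open>All three sums are brought to the range k < \<open>Suc n\<close>, so that
    Pascal's rule applies term by term.\<close>
  by (simp add: odd_part_upto[of "Suc n" "Suc n"] odd_part_upto[of n "Suc n"] even_part_upto[of n n]
      lessThan_Suc_atMost algebra_simps sum.distrib del: sum.lessThan_Suc)

lemma even_part_zero [simp]: "even_part n 0 = 1"
  by (simp add: even_part_def power_0_left if_distrib cong: if_cong)

lemma even_part_cong: "[x = y] (mod P) \<Longrightarrow> [even_part n x = even_part n y] (mod P)"
  unfolding even_part_def by (intro cong_sum cong_scalar_left cong_pow)

lemma odd_part_cong: "[x = y] (mod P) \<Longrightarrow> [odd_part n x = odd_part n y] (mod P)"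
  unfolding odd_part_def by (intro cong_sum cong_scalar_left cong_pow)

section \<open>Arithmetic of pairs u + v sqrt t\<close>

definition qmul :: "int \<Rightarrow> int \<times> int \<Rightarrow> int \<times> int \<Rightarrow> int \<times> int" where
  "qmul t z w = (fst z * fst w + t * snd z * snd w, fst z * snd w + snd z * fst w)"

primrec qpow :: "int \<Rightarrow> int \<times> int \<Rightarrow> nat \<Rightarrow> int \<times> int" where
  "qpow t z 0 = (1, 0)"
| "qpow t z (Suc n) = qmul t z (qpow t z n)"

definition qcong :: "int \<Rightarrow> int \<times> int \<Rightarrow> int \<times> int \<Rightarrow> bool" where
  "qcong P z w \<longleftrightarrow> [fst z = fst w] (mod P) \<and> [snd z = snd w] (mod P)"

lemma qmul_commute: "qmul t z w = qmul t w z"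
  by (simp add: qmul_def mult_ac add.commute)

lemma qmul_assoc: "qmul t (qmul t z w) v = qmul t z (qmul t w v)"
  by (simp add: qmul_def algebra_simps)

lemma qmul_one [simp]: "qmul t (1, 0) z = z" 
  by (simp add: qmul_def)

lemma qpow_add: "qpow t z (m + n) = qmul t (qpow t z m) (qpow t z n)"
  by (induction m) (simp_all add: qmul_assoc)

lemma qpow_qmul: "qpow t (qmul t z w) n = qmul t (qpow t z n) (qpow t w n)"
  by (induction n) (simp, metis qmul_assoc qmul_commute qpow.simps(2))

lemma qpow_double: "qpow t z (2 * n) = qpow t (qmul t z z) n"
  by (simp add: mult_2 qpow_add qpow_qmul)

lemma qpow_scalar: "qpow t (x, 0) n = (x ^ n, 0)"
  by (induction n) (simp_all add: qmul_def)

lemma qpow_root_even: "qpow t (0, 1) (2 * h) = (t ^ h, 0)"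
  by (simp add: qpow_double qpow_scalar, simp add: qmul_def qpow_scalar)

text \<open>Here e sqrt t plays the role of sqrt y with y = t e^2, and the extra factor
  \<open>e\<close> converts a coefficient of sqrt y into one of sqrt t. This links pairs to the two
  parts.\<close>

lemma qpow_one_plus:
  "qpow t (1, e) n = (even_part n (t * e\<^sup>2), e * odd_part n (t * e\<^sup>2))"
proof (induction n)
  case 0
  show ?case by (simp add: even_part_def odd_part_def)
next
  case (Suc n)
  then show ?case
    by (simp add: qmul_def even_part_Suc odd_part_Suc algebra_simps power2_eq_square)
qed

lemma qcong_refl [simp]: "qcong P z z"
  by (simp add: qcong_def)

lemma qcong_trans [trans]: "qcong P z w \<Longrightarrow> qcong P w v \<Longrightarrow> qcong P z v"
  unfolding qcong_def using cong_trans by blast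

lemma qcong_qmul: "qcong P z z' \<Longrightarrow> qcong P w w' \<Longrightarrow> qcong P (qmul t z w) (qmul t z' w')"
  by (simp add: qcong_def qmul_def cong_add cong_mult)

lemma qcong_qpow: "qcong P z w \<Longrightarrow> qcong P (qpow t z n) (qpow t w n)"
  by (induction n) (simp_all add: qcong_qmul)

section \<open>Powers modulo an odd prime\<close>

lemma prime_choose_cong_0:
  assumes "prime p" "0 < k" "k < p"
  shows "[int (p choose k) = 0] (mod int p)"
  using assms dvd_choose_prime[of k p] by (simp add: cong_0_iff)

text \<open>Modulo p only the outer coefficients of (1 + sqrt y)^p survive. As p is odd, index 0
  falls to the even part and index p to the odd part, where it leaves y^m.\<close>

lemma even_part_prime:
  assumes "prime p" "p = 2 * m + 1"
  shows "[even_part p y = 1] (mod int p)"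
proof -
  have "[(\<Sum>k\<le>m. int (p choose (2 * k)) * y ^ k) = (\<Sum>k\<le>m. if k = 0 then 1 else 0)] (mod int p)"
  proof (rule cong_sum)
    fix k
    assume "k \<in> {..m}"
    then have "k \<noteq> 0 \<Longrightarrow> [int (p choose (2 * k)) = 0] (mod int p)"
      using assms by (intro prime_choose_cong_0) auto
    \<comment> \<open>The fact used here still carries the premise \<open>k \<noteq> 0\<close>; the
      term k = 0 is settled by computation.\<close>
    from cong_mult[OF this cong_refl[of "y ^ k"]]
    show "[int (p choose (2 * k)) * y ^ k = (if k = 0 then 1 else 0)] (mod int p)"
      by auto
  qed
  then show ?thesis
    using assms(2) even_part_upto[of p m y] by simp
qed

lemma odd_part_prime:
  assumes "prime p" "p = 2 * m + 1"
  shows "[odd_part p y = y ^ m] (mod int p)"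
proof -
  have "[(\<Sum>k<Suc m. int (p choose (2 * k + 1)) * y ^ k) =
      (\<Sum>k<Suc m. if k = m then y ^ m else 0)] (mod int p)"
  proof (rule cong_sum)
    fix k
    assume "k \<in> {..<Suc m}"
    then have "k \<noteq> m \<Longrightarrow> [int (p choose (2 * k + 1)) = 0] (mod int p)"
      using assms by (intro prime_choose_cong_0) auto
    from cong_mult[OF this cong_refl[of "y ^ k"]]
    show "[int (p choose (2 * k + 1)) * y ^ k = (if k = m then y ^ m else 0)] (mod int p)"
      using assms(2) by (cases "k = m") (simp_all del: binomial_Suc_Suc)
  qed
  then show ?thesis
    using assms by (subst odd_part_upto[of p "Suc m"]) auto
qed

lemma coprime_int_prime:
  "prime p \<Longrightarrow> \<not> int p dvd x \<Longrightarrow> coprime x (int p)"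
  using prime_imp_coprime[of "int p" x] by (simp add: coprime_commute)

lemma odd_prime_not_dvd_power_two:
  assumes "prime p" "p = 2 * m + 1"
  shows "\<not> int p dvd 2 ^ n"
proof -
  have "\<not> int p dvd 2"
    using assms prime_gt_1_nat[OF assms(1)] zdvd_imp_le[of "int p" 2] by fastforce
  then show ?thesis
    using assms(1) prime_dvd_power[of "int p" 2 n] by auto
qed

lemma Legendre_cong_power:
  assumes "prime p" "p = 2 * m + 1"
  shows "[Legendre x (int p) = x ^ m] (mod int p)"
  using euler_criterion[of p x] assms prime_gt_1_nat[of p] by auto

text \<open>By Euler's criterion x^m is congruent to a Legendre symbol, here 1 or -1. Hence x^m is
  its own inverse modulo p, which later replaces every division by such a power.\<close>

lemma power_half_square:
  assumes "prime p" "p = 2 * m + 1" "\<not> int p dvd x"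
  shows "[x ^ m * x ^ m = 1] (mod int p)"
proof -
  have "Legendre x (int p) * Legendre x (int p) = 1"
    using assms(3) by (simp add: Legendre_def cong_0_iff)
  with Legendre_cong_power[OF assms(1,2), of x] show ?thesis
    by (metis cong_mult cong_sym)
qed

lemma inverse_mod_prime:
  assumes "prime p" "\<not> int p dvd x"
  obtains u where "[x * u = 1] (mod int p)"
  using cong_solve_coprime_int[OF coprime_int_prime[OF assms]] by blast

text \<open>The Frobenius map on \<open>\<int>[\<surd>t]\<close> modulo \<open>p\<close>.\<close>

lemma qpow_prime:
  assumes p: "prime p" "p = 2 * m + 1" and x: "\<not> int p dvd x"
  shows "qcong (int p) (qpow t (x, 1) p) (x, t ^ m)"
proof -
  obtain f where f: "[x * f = 1] (mod int p)"
    using inverse_mod_prime[OF p(1) x] .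
  have f2: "[f ^ m * f ^ m = 1] (mod int p)" and x2: "[x ^ m * x ^ m = 1] (mod int p)"
  proof -
    have "\<not> int p dvd x * f"
      using cong_dvd_iff[OF f] p by auto
    then have "\<not> int p dvd f"
      by auto
    then show "[f ^ m * f ^ m = 1] (mod int p)" "[x ^ m * x ^ m = 1] (mod int p)"
      using power_half_square p x by blast+
  qed
  \<comment> \<open>With \<open>f\<close> inverse to \<open>x\<close>, x + sqrt t is x (1 + f sqrt
    t), whose second factor has the shape treated by \<open>qpow_one_plus\<close>.\<close>
  have "qcong (int p) (qpow t (x, 1) p) (qpow t (qmul t (x, 0) (1, f)) p)"
    using f by (intro qcong_qpow) (simp add: qcong_def qmul_def cong_sym)
  also have "qpow t (qmul t (x, 0) (1, f)) p =
      qmul t (x ^ p, 0) (even_part p (t * f\<^sup>2), f * odd_part p (t * f\<^sup>2))"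
    by (simp add: qpow_qmul qpow_scalar qpow_one_plus)
  also have "qcong (int p) \<dots> (qmul t (x, 0) (1, f * (t * f\<^sup>2) ^ m))"
  proof (rule qcong_qmul)
    have "x ^ p = (x ^ m * x ^ m) * x"
      using p by (simp add: mult_2 power_add)
    with cong_mult[OF x2 cong_refl[of x]] show "qcong (int p) (x ^ p, 0) (x, 0)"
      by (simp add: qcong_def)
    show "qcong (int p) (even_part p (t * f\<^sup>2), f * odd_part p (t * f\<^sup>2)) (1, f * (t * f\<^sup>2) ^ m)"
      using even_part_prime[OF p] odd_part_prime[OF p] by (simp add: qcong_def cong_mult)
  qed
  also have "qcong (int p) \<dots> (x, t ^ m)"
  proof -
    \<comment> \<open>Regrouped so that x f and f^(2m), both congruent to 1, drop out and only t^m
      remains.\<close>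
    have eq: "(x * f) * (f ^ m * f ^ m) * t ^ m = x * (f * (t * f\<^sup>2) ^ m)"
      by (simp add: power_mult_distrib power2_eq_square)
    from cong_mult[OF cong_mult[OF f f2] cong_refl[of "t ^ m"]] show ?thesis
      unfolding eq by (simp add: qcong_def qmul_def)
  qed
  finally show ?thesis .
qed

section \<open>The even and odd parts at exponent (p + 1) / 2\<close>

text \<open>\<open>e\<close> represents (a + b) / (2ab). The identity \<open>base\<close>, with s =
  sqrt t, reads 2ta (1 + e s) = s (a + s)^2; its power \<open>Suc m\<close> contains (a + s)^(p+1) =
  (a + s) (a + s)^p, and \<open>qpow_prime\<close> evaluates the last factor.\<close>

lemma one_plus_root_power_cong:
  assumes p: "prime p" "p = 2 * m + 1" and a: "\<not> int p dvd a"
    and e: "[2 * a * b * e = a + b] (mod int p)" and t: "t = a * b"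
  shows "qcong (int p)
    ((2 * t * a) ^ Suc m * even_part (Suc m) (t * e\<^sup>2),
     (2 * t * a) ^ Suc m * (e * odd_part (Suc m) (t * e\<^sup>2)))
    (qmul t (qpow t (0, 1) (Suc m)) (a\<^sup>2 + t * t ^ m, a + a * t ^ m))"
proof -
  have base: "qcong (int p) (qmul t (2 * t * a, 0) (1, e)) (qmul t (0, 1) (qmul t (a, 1) (a, 1)))"
  proof -
    have "[a * (2 * a * b * e) = a * (a + b)] (mod int p)"
      using e by (rule cong_scalar_left)
    then show ?thesis
      by (simp add: qcong_def qmul_def t algebra_simps)
  qed
  have "2 * Suc m = Suc p"
    using p by simp
  have "((2 * t * a) ^ Suc m * even_part (Suc m) (t * e\<^sup>2),
       (2 * t * a) ^ Suc m * (e * odd_part (Suc m) (t * e\<^sup>2))) =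
      qpow t (qmul t (2 * t * a, 0) (1, e)) (Suc m)"
    by (simp only: qpow_qmul qpow_scalar qpow_one_plus) (simp add: qmul_def)
  also have "qcong (int p) \<dots> (qpow t (qmul t (0, 1) (qmul t (a, 1) (a, 1))) (Suc m))"
    using base by (rule qcong_qpow)
  also have "qpow t (qmul t (0, 1) (qmul t (a, 1) (a, 1))) (Suc m) =
      qmul t (qpow t (0, 1) (Suc m)) (qpow t (a, 1) (2 * Suc m))"
    by (simp only: qpow_qmul[of t "(0, 1)"] qpow_double)
  also have "\<dots> = qmul t (qpow t (0, 1) (Suc m)) (qmul t (a, 1) (qpow t (a, 1) p))"
    by (simp only: \<open>2 * Suc m = Suc p\<close> qpow.simps)
  also have "qcong (int p) \<dots> (qmul t (qpow t (0, 1) (Suc m)) (qmul t (a, 1) (a, t ^ m)))"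
    by (intro qcong_qmul qcong_refl qpow_prime p a)
  also have "qmul t (a, 1) (a, t ^ m) = (a\<^sup>2 + t * t ^ m, a + a * t ^ m)"
    by (simp add: qmul_def power2_eq_square)
  finally show ?thesis .
qed

text \<open>The factor (2ab * a)^m is congruent to 2^m b^m because a^(2m) is 1, and 2^m b^m is its
  own inverse, so it moves to the right. In the second claim 2abe is also replaced by a + b.
  \<open>Z\<close> stays a pair because the power of sqrt(ab) in it depends on the parity of
  m.\<close>

lemma parts_cong:
  assumes p: "prime p" "p = 2 * m + 1" and a: "\<not> int p dvd a" and b: "\<not> int p dvd b"
    and e: "[2 * a * b * e = a + b] (mod int p)"
    and Z: "Z = qmul (a * b) (qpow (a * b) (0, 1) (Suc m))
      (a\<^sup>2 + a * b * (a ^ m * b ^ m), a + a * (a ^ m * b ^ m))"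
  shows "[2 * a * b * a * even_part (Suc m) (a * b * e\<^sup>2) = 2 ^ m * b ^ m * fst Z] (mod int p)"
    and "[a * (a + b) * odd_part (Suc m) (a * b * e\<^sup>2) = 2 ^ m * b ^ m * snd Z] (mod int p)"
proof -
  define P \<alpha> \<beta> \<delta> E D where
    defs: "P = int p" "\<alpha> = a ^ m" "\<beta> = b ^ m" "\<delta> = (2::int) ^ m"
    "E = even_part (Suc m) (a * b * e\<^sup>2)" "D = odd_part (Suc m) (a * b * e\<^sup>2)"
  have "\<not> int p dvd 2"
    using odd_prime_not_dvd_power_two[OF p, of 1] by simp
  then have "[(\<delta> * \<delta>) * (\<alpha> * \<alpha>) * (\<beta> * \<beta>) = 1 * 1 * 1] (mod P)"
    unfolding defs by (intro cong_mult power_half_square[OF p] a b)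
  then have W: "P dvd (\<delta> * \<delta>) * (\<alpha> * \<alpha>) * (\<beta> * \<beta>) - 1"
    by (simp add: cong_iff_dvd_diff)
  have e': "P dvd 2 * a * b * e - (a + b)"
    using e by (simp add: cong_iff_dvd_diff defs)
  have "(2 * (a * b) * a) ^ Suc m = 2 * a * b * a * (\<delta> * \<alpha> * \<beta> * \<alpha>)"
    by (simp add: defs power_mult_distrib)
  moreover have "(a * b) ^ m = \<alpha> * \<beta>"
    by (simp add: defs power_mult_distrib)
  ultimately have "qcong P (2 * a * b * a * (\<delta> * \<alpha> * \<beta> * \<alpha>) * E, 2 * a * b * a * (\<delta> * \<alpha> * \<beta> * \<alpha>) * (e * D)) Z"
    using one_plus_root_power_cong[OF p a e refl] by (simp only: defs Z)
  then have X: "P dvd 2 * a * b * a * (\<delta> * \<alpha> * \<beta> * \<alpha>) * E - fst Z"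
      "P dvd 2 * a * b * a * (\<delta> * \<alpha> * \<beta> * \<alpha>) * (e * D) - snd Z"
    by (simp_all add: qcong_def cong_iff_dvd_diff)
  \<comment> \<open>An explicit combination of the known multiples of \<open>P\<close>: the product
    of the three squares is replaced by 1.\<close>
  have "2 * a * b * a * E - \<delta> * \<beta> * fst Z =
      \<delta> * \<beta> * (2 * a * b * a * (\<delta> * \<alpha> * \<beta> * \<alpha>) * E - fst Z)
      - 2 * a * b * a * E * ((\<delta> * \<delta>) * (\<alpha> * \<alpha>) * (\<beta> * \<beta>) - 1)"
    by (simp add: algebra_simps)
  then have "P dvd 2 * a * b * a * E - \<delta> * \<beta> * fst Z"
    using X W by (metis dvd_diff dvd_mult)
  then show "[2 * a * b * a * even_part (Suc m) (a * b * e\<^sup>2) = 2 ^ m * b ^ m * fst Z] (mod int p)"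
    by (simp add: cong_iff_dvd_diff defs)
  have "a * (a + b) * D - \<delta> * \<beta> * snd Z =
      \<delta> * \<beta> * (2 * a * b * a * (\<delta> * \<alpha> * \<beta> * \<alpha>) * (e * D) - snd Z)
      - 2 * a * b * a * e * D * ((\<delta> * \<delta>) * (\<alpha> * \<alpha>) * (\<beta> * \<beta>) - 1)
      - a * D * (2 * a * b * e - (a + b))"
    by (simp add: algebra_simps)
  then have "P dvd a * (a + b) * D - \<delta> * \<beta> * snd Z"
    using X W e' by (metis dvd_diff dvd_mult)
  then show "[a * (a + b) * odd_part (Suc m) (a * b * e\<^sup>2) = 2 ^ m * b ^ m * snd Z] (mod int p)"
    by (simp add: cong_iff_dvd_diff defs)
qed

text \<open>For even m the exponent \<open>Suc m\<close> is odd, so sqrt(ab)^(m+1) is (ab)^h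
  sqrt(ab). This factor interchanges the two components, and \<beta>^2 = 1 makes the result
  symmetric in \<open>a\<close> and \<open>b\<close>.\<close>

lemma parts_cong_even:
  assumes p: "prime p" "p = 2 * m + 1" and a: "\<not> int p dvd a" and b: "\<not> int p dvd b"
    and e: "[2 * a * b * e = a + b] (mod int p)" and h: "m = 2 * h"
  shows "[2 * even_part (Suc m) (a * b * e\<^sup>2) = 2 ^ m * (a * b) ^ h * (a ^ m + b ^ m)] (mod int p)"
    and "[(a + b) * odd_part (Suc m) (a * b * e\<^sup>2) =
      2 ^ m * (a * b) ^ h * (a * b ^ m + b * a ^ m)] (mod int p)"
proof -
  define P \<alpha> \<beta> \<delta> r E D where
    defs: "P = int p" "\<alpha> = a ^ m" "\<beta> = b ^ m" "\<delta> = (2::int) ^ m" "r = (a * b) ^ h"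
    "E = even_part (Suc m) (a * b * e\<^sup>2)" "D = odd_part (Suc m) (a * b * e\<^sup>2)"
  have "qpow (a * b) (0, 1) (Suc m) = (0, r)"
    by (simp add: h qpow_root_even) (simp add: qmul_def defs)
  then have "[2 * a * b * a * E = \<delta> * \<beta> * (a * b * r * (a + a * (\<alpha> * \<beta>)))] (mod P)"
    "[a * (a + b) * D = \<delta> * \<beta> * (r * (a\<^sup>2 + a * b * (\<alpha> * \<beta>)))] (mod P)"
    \<comment> \<open>\<open>r\<close> stays folded and the recursion of \<open>qpow\<close> is
      switched off, so that the value of the power just found can be inserted.\<close>
    using parts_cong[OF p a b e refl] by (simp_all add: defs(1-4,6,7) qmul_def del: qpow.simps)
  moreover have "[\<beta> * \<beta> = 1] (mod P)"
    unfolding defs by (intro power_half_square[OF p] b)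
  ultimately have
      X: "P dvd 2 * a * b * a * E - \<delta> * \<beta> * (a * b * r * (a + a * (\<alpha> * \<beta>)))"
        "P dvd a * (a + b) * D - \<delta> * \<beta> * (r * (a\<^sup>2 + a * b * (\<alpha> * \<beta>)))"
    and bb: "P dvd \<beta> * \<beta> - 1"
    by (simp_all add: cong_iff_dvd_diff)
  have "(2 * a * b * a * E - \<delta> * \<beta> * (a * b * r * (a + a * (\<alpha> * \<beta>)))) + a * b * a * \<delta> * r * \<alpha> * (\<beta> * \<beta> - 1) =
      a * b * a * (2 * E - \<delta> * r * (\<alpha> + \<beta>))"
    by (simp add: algebra_simps)
  then have "P dvd a * b * a * (2 * E - \<delta> * r * (\<alpha> + \<beta>))"
    using X bb by (metis dvd_add dvd_mult)
  moreover have "prime P"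
    using p(1) by (simp add: defs)
  ultimately show "[2 * even_part (Suc m) (a * b * e\<^sup>2) = 2 ^ m * (a * b) ^ h * (a ^ m + b ^ m)] (mod int p)"
    using a b by (simp add: prime_dvd_mult_iff cong_iff_dvd_diff flip: defs)
  have "(a * (a + b) * D - \<delta> * \<beta> * (r * (a\<^sup>2 + a * b * (\<alpha> * \<beta>)))) + a * \<delta> * r * b * \<alpha> * (\<beta> * \<beta> - 1) =
      a * ((a + b) * D - \<delta> * r * (a * \<beta> + b * \<alpha>))"
    by (simp add: algebra_simps power2_eq_square)
  then have "P dvd a * ((a + b) * D - \<delta> * r * (a * \<beta> + b * \<alpha>))"
    using X bb by (metis dvd_add dvd_mult)
  with \<open>prime P\<close> show "[(a + b) * odd_part (Suc m) (a * b * e\<^sup>2) =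
      2 ^ m * (a * b) ^ h * (a * b ^ m + b * a ^ m)] (mod int p)"
    using a by (simp add: prime_dvd_mult_iff cong_iff_dvd_diff flip: defs)
qed

text \<open>Now sqrt(ab)^(m+1) is the scalar (ab)^h and the components stay in place. The first one
  has no factor ab to cancel, hence the \<open>a * b\<close> left in front of the even part.\<close>

lemma parts_cong_odd:
  assumes p: "prime p" "p = 2 * m + 1" and a: "\<not> int p dvd a" and b: "\<not> int p dvd b"
    and e: "[2 * a * b * e = a + b] (mod int p)" and h: "Suc m = 2 * h"
  shows "[2 * a * b * even_part (Suc m) (a * b * e\<^sup>2) =
      2 ^ m * (a * b) ^ h * (a * b ^ m + b * a ^ m)] (mod int p)"
    and "[(a + b) * odd_part (Suc m) (a * b * e\<^sup>2) = 2 ^ m * (a * b) ^ h * (a ^ m + b ^ m)] (mod int p)"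
proof -
  define P \<alpha> \<beta> \<delta> r E D where
    defs: "P = int p" "\<alpha> = a ^ m" "\<beta> = b ^ m" "\<delta> = (2::int) ^ m" "r = (a * b) ^ h"
    "E = even_part (Suc m) (a * b * e\<^sup>2)" "D = odd_part (Suc m) (a * b * e\<^sup>2)"
  have "qpow (a * b) (0, 1) (Suc m) = (r, 0)"
    by (simp only: h qpow_root_even) (simp add: defs)
  then have "[2 * a * b * a * E = \<delta> * \<beta> * (r * (a\<^sup>2 + a * b * (\<alpha> * \<beta>)))] (mod P)"
    "[a * (a + b) * D = \<delta> * \<beta> * (r * (a + a * (\<alpha> * \<beta>)))] (mod P)"
    using parts_cong[OF p a b e refl] by (simp_all add: defs(1-4,6,7) qmul_def del: qpow.simps)
  moreover have "[\<beta> * \<beta> = 1] (mod P)"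
    unfolding defs by (intro power_half_square[OF p] b)
  ultimately have
      X: "P dvd 2 * a * b * a * E - \<delta> * \<beta> * (r * (a\<^sup>2 + a * b * (\<alpha> * \<beta>)))"
        "P dvd a * (a + b) * D - \<delta> * \<beta> * (r * (a + a * (\<alpha> * \<beta>)))"
    and bb: "P dvd \<beta> * \<beta> - 1"
    by (simp_all add: cong_iff_dvd_diff)
  have "(2 * a * b * a * E - \<delta> * \<beta> * (r * (a\<^sup>2 + a * b * (\<alpha> * \<beta>)))) + a * \<delta> * r * b * \<alpha> * (\<beta> * \<beta> - 1) =
      a * (2 * a * b * E - \<delta> * r * (a * \<beta> + b * \<alpha>))"
    by (simp add: algebra_simps power2_eq_square)
  then have "P dvd a * (2 * a * b * E - \<delta> * r * (a * \<beta> + b * \<alpha>))"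
    using X bb by (metis dvd_add dvd_mult)
  moreover have "prime P"
    using p(1) by (simp add: defs)
  ultimately show "[2 * a * b * even_part (Suc m) (a * b * e\<^sup>2) =
      2 ^ m * (a * b) ^ h * (a * b ^ m + b * a ^ m)] (mod int p)"
    using a by (simp add: prime_dvd_mult_iff cong_iff_dvd_diff flip: defs)
  have "(a * (a + b) * D - \<delta> * \<beta> * (r * (a + a * (\<alpha> * \<beta>)))) + a * \<delta> * r * \<alpha> * (\<beta> * \<beta> - 1) =
      a * ((a + b) * D - \<delta> * r * (\<alpha> + \<beta>))"
    by (simp add: algebra_simps)
  then have "P dvd a * ((a + b) * D - \<delta> * r * (\<alpha> + \<beta>))"
    using X bb by (metis dvd_add dvd_mult)
  with \<open>prime P\<close> show "[(a + b) * odd_part (Suc m) (a * b * e\<^sup>2) =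
      2 ^ m * (a * b) ^ h * (a ^ m + b ^ m)] (mod int p)"
    using a by (simp add: prime_dvd_mult_iff cong_iff_dvd_diff flip: defs)
qed

text \<open>The degenerate instance \<open>a = 1\<close>, \<open>b = -1\<close>, \<open>e = 0\<close> is the second supplementary law.\<close>

lemma two_power_half_even:
  assumes p: "prime p" "p = 2 * m + 1" and h: "m = 2 * h"
  shows "[2 ^ m = (-1) ^ h] (mod int p)"
proof -
  have "\<not> int p dvd 1" "\<not> int p dvd 2"
    using odd_prime_not_dvd_power_two[OF p, of 0] odd_prime_not_dvd_power_two[OF p, of 1] by simp_all
  \<comment> \<open>Since a + b = 0, \<open>e = 0\<close> is admissible and the even part at 0 is 1;
    for even m also a^m + b^m = 2.\<close>
  then have "[2 * 1 = 2 * (2 ^ m * (-1) ^ h)] (mod int p)"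
    using parts_cong_even(1)[OF p, of 1 "-1" 0 h] h by (simp add: mult_ac)
  then have "[1 = 2 ^ m * (-1) ^ h] (mod int p)"
    using cong_mult_lcancel[OF coprime_int_prime[OF p(1) \<open>\<not> int p dvd 2\<close>]] by blast
  from cong_mult[OF this cong_refl[of "(-1) ^ h"]] show ?thesis
    by (simp add: cong_sym mult.assoc flip: power_mult_distrib)
qed

lemma two_power_half_odd:
  assumes p: "prime p" "p = 2 * m + 1" and h: "Suc m = 2 * h"
  shows "[2 ^ m = (-1) ^ h] (mod int p)"
proof -
  have "odd m" using h by presburger
  have "\<not> int p dvd 1" "\<not> int p dvd 2"
    using odd_prime_not_dvd_power_two[OF p, of 0] odd_prime_not_dvd_power_two[OF p, of 1] by simp_all
  \<comment> \<open>For odd m both 2ab and a b^m + b a^m equal -2.\<close>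
  then have "[-2 * 1 = -2 * (2 ^ m * (-1) ^ h)] (mod int p)"
    using parts_cong_odd(1)[OF p, of 1 "-1" 0 h] h \<open>odd m\<close> by (simp add: mult_ac)
  then have "[1 = 2 ^ m * (-1) ^ h] (mod int p)"
    using cong_mult_lcancel[OF coprime_int_prime[OF p(1), of "-2"]] \<open>\<not> int p dvd 2\<close>
    by (metis dvd_minus_iff)
  from cong_mult[OF this cong_refl[of "(-1) ^ h"]] show ?thesis
    by (simp add: cong_sym mult.assoc flip: power_mult_distrib)
qed

subsection \<open>Central binomial coefficients and Catalan numbers modulo a prime\<close>

definition central :: "nat \<Rightarrow> nat" where
  "central n = (2 * n) choose n"

lemma central_0 [simp]: "central 0 = 1"
  by (simp add: central_def)

lemma central_Suc: "int (Suc n) * int (central (Suc n)) = 2 * (2 * int n + 1) * int (central n)"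
proof -
  have "Suc n * (Suc (2 * n) choose Suc n) = Suc (2 * n) * (2 * n choose n)"
    by (rule Suc_times_binomial)
  moreover have "central (Suc n) = 2 * (Suc (2 * n) choose Suc n)"
    using binomial_symmetric[of n "Suc (2 * n)"] by (simp add: central_def)
  ultimately have "Suc n * central (Suc n) = 2 * (2 * n + 1) * central n"
    by (simp add: central_def algebra_simps)
  then show ?thesis
    by (metis of_nat_mult of_nat_add of_nat_1 of_nat_numeral)
qed

lemma cong_cancel_Suc:
  assumes "prime p" "Suc n < p" "[int (Suc n) * x = int (Suc n) * y] (mod int p)"
  shows "[x = y] (mod int p)"
proof -
  have "\<not> int p dvd int (Suc n)"
    using assms by (auto dest: zdvd_imp_le)
  from coprime_int_prime[OF assms(1) this] assms(3) show ?thesis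
    using cong_mult_lcancel by blast
qed

text \<open>Modulo p, m is -1/2, so this is the expansion of (2n choose n) as (-4)^n times the
  binomial coefficient of -1/2. Both sides obey the same first-order recurrence, and
  \<open>Suc n\<close> < p may be cancelled in it.\<close>

lemma central_cong:
  assumes p: "prime p" "p = 2 * m + 1" and n: "n < p"
  shows "[int (central n) = (-4) ^ n * int (m choose n)] (mod int p)"
  using n
proof (induction n)
  case 0
  show ?case by simp
next
  case (Suc n)
  have binom: "int (Suc n) * int (m choose Suc n) = (int m - int n) * int (m choose n)"
  proof (cases "n \<le> m")
    case True
    have "Suc n * (m choose Suc n) = (m - n) * (m choose n)"
      using binomial_absorb_comp[of m n] binomial_absorption[of n m] by simp
    then show ?thesis
      using True by (metis of_nat_diff of_nat_mult)
  next
    case False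
    then show ?thesis by (simp add: binomial_eq_0)
  qed
  have "int (Suc n) * int (central (Suc n)) = 2 * (2 * int n + 1) * int (central n)"
    by (rule central_Suc)
  also have "[\<dots> = 2 * (2 * int n + 1) * ((-4) ^ n * int (m choose n))] (mod int p)"
    using Suc by (intro cong_scalar_left) simp
  also have "[2 * (2 * int n + 1) * ((-4) ^ n * int (m choose n)) =
      -4 * (int m - int n) * ((-4) ^ n * int (m choose n))] (mod int p)"
  proof (rule cong_scalar_right)
    \<comment> \<open>The difference is 4m + 2 = 2p.\<close>
    have "2 * (2 * int n + 1) - (-4 * (int m - int n)) = int p * 2"
      using p by simp
    then show "[2 * (2 * int n + 1) = -4 * (int m - int n)] (mod int p)"
      unfolding cong_iff_dvd_diff by (metis dvd_triv_left)
  qed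
  also have "-4 * (int m - int n) * ((-4) ^ n * int (m choose n)) =
      (-4) ^ Suc n * ((int m - int n) * int (m choose n))"
    by (simp add: algebra_simps)
  also have "\<dots> = int (Suc n) * ((-4) ^ Suc n * int (m choose Suc n))"
    by (simp only: binom[symmetric]) simp
  finally show ?case
    using cong_cancel_Suc[OF p(1) Suc.prems] by blast
qed

text \<open>(2p choose p) is the sum of the squares of (p choose k), and p divides all of these
  binomials except the two outer ones.\<close>

lemma central_prime:
  assumes "prime p"
  shows "[int (central p) = 2] (mod int p)"
proof -
  have "[(\<Sum>k\<le>p. int (p choose k) ^ 2) = (\<Sum>k\<le>p. if k = 0 \<or> k = p then 1 else 0)] (mod int p)"
  proof (rule cong_sum)
    fix k
    assume "k \<in> {..p}"
    then have "[int (p choose k) = (if k = 0 \<or> k = p then 1 else 0)] (mod int p)"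
      using prime_choose_cong_0[OF assms, of k] by auto
    from cong_pow[OF this, of 2]
    show "[int (p choose k) ^ 2 = (if k = 0 \<or> k = p then 1 else 0)] (mod int p)"
      by (cases "k = 0 \<or> k = p") simp_all
  qed
  moreover have "(\<Sum>k\<le>p. int (p choose k) ^ 2) = int (central p)"
    by (simp add: central_def flip: choose_square_sum)
  moreover have "(\<Sum>k\<le>p. if k = 0 \<or> k = p then 1 else 0 :: int) = (\<Sum>k\<in>{0, p}. 1)"
    by (intro sum.mono_neutral_cong_right) auto
  moreover have "(\<Sum>k\<in>{0, p}. 1 :: int) = 2"
    using prime_gt_0_nat[OF assms] by simp
  ultimately show ?thesis by simp
qed

text \<open>The recurrence \<open>central_Suc\<close> has the same coefficients modulo p at p + n as
  at n, so the factor 2 found at n = 0 propagates.\<close>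

lemma central_add_prime:
  assumes p: "prime p" and n: "n < p"
  shows "[int (central (p + n)) = 2 * int (central n)] (mod int p)"
  using n
proof (induction n)
  case 0
  show ?case using central_prime[OF p] by simp
next
  case (Suc n)
  have "[int (Suc n) * int (central (p + Suc n)) = int (Suc (p + n)) * int (central (Suc (p + n)))] (mod int p)"
    using cong_scalar_right[of "int (Suc n)" "int (Suc (p + n))" "int p" "int (central (Suc (p + n)))"]
    by (simp add: cong_iff_dvd_diff)
  also have "int (Suc (p + n)) * int (central (Suc (p + n))) =
      2 * (2 * int (p + n) + 1) * int (central (p + n))"
    by (rule central_Suc)
  also have "[\<dots> = 2 * (2 * int n + 1) * (2 * int (central n))] (mod int p)"
    using Suc by (intro cong_mult) (simp_all add: cong_iff_dvd_diff)
  also have "2 * (2 * int n + 1) * (2 * int (central n)) =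
      int (Suc n) * (2 * int (central (Suc n)))"
    using central_Suc[of n] by simp
  finally show ?case
    using cong_cancel_Suc[OF p Suc.prems] by blast
qed

text \<open>From C_n = (4 c_n - c_(n+1)) / 2 with c_n = \<open>central n\<close>. No division by n +
  1 occurs, so the index p - 1 causes no trouble modulo p.\<close>

definition catalan_int :: "nat \<Rightarrow> int" where
  "catalan_int n = (4 * int (central n) - int (central (Suc n))) div 2"

lemma two_catalan_int: "2 * catalan_int n = 4 * int (central n) - int (central (Suc n))"
proof -
  \<comment> \<open>(2n+2 choose n+1) is the sum of two equal neighbours in Pascal's triangle, so
    the division by 2 is exact.\<close>
  have "even (central (Suc n))"
    using binomial_symmetric[of n "Suc (2 * n)"] by (simp add: central_def)
  then show ?thesis
    by (simp add: catalan_int_def)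
qed

lemma catalan_eq_int: "catalan n = rat_of_int (catalan_int n)"
proof -
  have "int (Suc n) * (2 * catalan_int n) = 2 * int (central n)"
    using central_Suc[of n] unfolding two_catalan_int by (simp add: algebra_simps)
  then have "int (Suc n) * catalan_int n = int (central n)"
    by simp
  then have "rat_of_int (int (Suc n)) * rat_of_int (catalan_int n) = rat_of_int (int (central n))"
    by (metis of_int_mult)
  then show ?thesis
    by (simp add: catalan_def central_def field_simps)
qed

lemma cong_cancel_two:
  assumes "prime p" "p > 2" "[2 * x = 2 * y] (mod int p)"
  shows "[x = y] (mod int p)"
  using cong_cancel_Suc[of p 1 x y] assms by simp

text \<open>Pascal's rule merges the two terms that \<open>central_cong\<close> gives for
  \<open>two_catalan_int\<close>.\<close>

lemma catalan_int_cong: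
  assumes p: "prime p" "p = 2 * m + 1" and n: "Suc n < p"
  shows "[catalan_int n = 2 * (-4) ^ n * int (Suc m choose Suc n)] (mod int p)"
proof -
  have "p > 2" using p(2) prime_gt_1_nat[OF p(1)] by simp
  have "[2 * catalan_int n = 4 * ((-4) ^ n * int (m choose n)) - (-4) ^ Suc n * int (m choose Suc n)] (mod int p)"
    unfolding two_catalan_int using n by (intro cong_diff cong_scalar_left central_cong p) auto
  then have "[2 * catalan_int n = 2 * (2 * (-4) ^ n * int (Suc m choose Suc n))] (mod int p)"
    by (simp add: algebra_simps)
  then show ?thesis
    using cong_cancel_two[OF p(1) \<open>p > 2\<close>] by blast
qed

text \<open>At index p - 1 the second term of \<open>two_catalan_int\<close> is
  \<open>central p\<close>, beyond the range of \<open>central_cong\<close> but known to be 2; the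
  first term vanishes because m < 2m.\<close>

lemma catalan_int_prime_minus_one:
  assumes p: "prime p" "p = 2 * m + 1"
  shows "[catalan_int (2 * m) = -1] (mod int p)"
proof -
  have "p > 2" using p(2) prime_gt_1_nat[OF p(1)] by simp
  then have "m < 2 * m" using p by auto
  have "[2 * catalan_int (2 * m) = 4 * ((-4) ^ (2 * m) * int (m choose (2 * m))) - 2] (mod int p)"
    unfolding two_catalan_int using p central_prime[OF p(1)]
    by (intro cong_diff cong_scalar_left central_cong p) auto
  then have "[2 * catalan_int (2 * m) = 2 * -1] (mod int p)"
    using \<open>m < 2 * m\<close> by (simp add: binomial_eq_0)
  then show ?thesis
    using cong_cancel_two[OF p(1) \<open>p > 2\<close>] by blast
qed

lemma catalan_int_add_prime:
  assumes p: "prime p" "p > 2" and n: "Suc n < p"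
  shows "[catalan_int (p + n) = 2 * catalan_int n] (mod int p)"
proof -
  have "[2 * catalan_int (p + n) = 4 * (2 * int (central n)) - 2 * int (central (Suc n))] (mod int p)"
    unfolding two_catalan_int add_Suc_right[symmetric] using n
    by (intro cong_diff cong_scalar_left central_add_prime p) auto
  also have "4 * (2 * int (central n)) - 2 * int (central (Suc n)) = 2 * (2 * catalan_int n)"
    using two_catalan_int[of n] by simp
  finally show ?thesis
    using cong_cancel_two[OF p] by blast
qed

section \<open>Reduction of the two sums to even and odd parts\<close>

lemma sum_lessThan_add:
  fixes g :: "nat \<Rightarrow> int"
  shows "(\<Sum>k<a + b. g k) = (\<Sum>k<a. g k) + (\<Sum>j<b. g (a + j))"
  by (induction b) simp_all

text \<open>The cut suits the index 2k: it stays below p for k \<le> m, and for k = m + 1 + j it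
  equals p + (2j + 1). The blocks thus produce binomials of opposite parity.\<close>

lemma sum_split_prime:
  fixes g :: "nat \<Rightarrow> int"
  assumes "p = 2 * m + 1"
  shows "(\<Sum>k=0..p-1. g k) = (\<Sum>k\<le>m. g k) + (\<Sum>j<m. g (Suc m + j))"
proof -
  have "{0..p-1} = {..<Suc m + m}"
    using assms by auto
  then show ?thesis
    by (simp only: sum_lessThan_add lessThan_Suc_atMost)
qed

lemma four_power_even: "(4 :: int) ^ (2 * k) = 16 ^ k"
  by (simp add: power_mult)

text \<open>In the second block the shift by p gives a 2, and 2 (-4)^(2j+1) q^(j+1) equals -y^(j+1)
  / 2; doubling the sum keeps everything integral.\<close>

lemma sum_central:
  assumes p: "prime p" "p = 2 * m + 1" and y: "y = 16 * q"
  shows "[2 * (\<Sum>k=0..p-1. int (central (2 * k)) * q ^ k) =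
    2 * even_part m y - q ^ m * y * odd_part m y] (mod int p)"
proof -
  have "[(\<Sum>k\<le>m. int (central (2 * k)) * q ^ k) = (\<Sum>k\<le>m. (-4) ^ (2 * k) * int (m choose (2 * k)) * q ^ k)] (mod int p)"
    using p by (intro cong_sum cong_scalar_right central_cong) auto
  also have "(\<Sum>k\<le>m. (-4) ^ (2 * k) * int (m choose (2 * k)) * q ^ k) = even_part m y"
    by (simp add: even_part_def y four_power_even power_mult_distrib mult.assoc mult.left_commute)
  finally have A: "[(\<Sum>k\<le>m. int (central (2 * k)) * q ^ k) = even_part m y] (mod int p)" .
  have "[(\<Sum>j<m. int (central (2 * (Suc m + j))) * q ^ (Suc m + j)) =
      (\<Sum>j<m. 2 * ((-4) ^ (2 * j + 1) * int (m choose (2 * j + 1))) * q ^ (Suc m + j))] (mod int p)"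
  proof (intro cong_sum cong_scalar_right)
    fix j
    assume "j \<in> {..<m}"
    then have lt: "2 * j + 1 < p" using p by auto
    have "2 * (Suc m + j) = p + (2 * j + 1)" using p by auto
    then have "[int (central (2 * (Suc m + j))) = 2 * int (central (2 * j + 1))] (mod int p)"
      using central_add_prime[OF p(1) lt] by (simp only:)
    also have "[2 * int (central (2 * j + 1)) = 2 * ((-4) ^ (2 * j + 1) * int (m choose (2 * j + 1)))] (mod int p)"
      by (intro cong_scalar_left central_cong p lt)
    finally show "[int (central (2 * (Suc m + j))) = 2 * ((-4) ^ (2 * j + 1) * int (m choose (2 * j + 1)))] (mod int p)" .
  qed
  from cong_scalar_left[OF this, of 2]
  have "[2 * (\<Sum>j<m. int (central (2 * (Suc m + j))) * q ^ (Suc m + j)) =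
      2 * (\<Sum>j<m. 2 * ((-4) ^ (2 * j + 1) * int (m choose (2 * j + 1))) * q ^ (Suc m + j))] (mod int p)" .
  also have "2 * (\<Sum>j<m. 2 * ((-4) ^ (2 * j + 1) * int (m choose (2 * j + 1))) * q ^ (Suc m + j)) =
      - (q ^ m * y * odd_part m y)"
    by (simp add: odd_part_upto[of m m] y four_power_even power_mult_distrib power_add
        sum_distrib_left mult.assoc mult.left_commute flip: sum_negf)
  finally have B: "[2 * (\<Sum>j<m. int (central (2 * (Suc m + j))) * q ^ (Suc m + j)) =
      - (q ^ m * y * odd_part m y)] (mod int p)" .
  show ?thesis
    using cong_add[OF cong_scalar_left[OF A, of 2] B] unfolding sum_split_prime[OF p(2)]
    by (simp add: algebra_simps)
qed

text \<open>The second block yields the even part without its constant term 1, times -q^m. The term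
  k = m of the first block, of Catalan index p - 1, is congruent to -q^m and supplies exactly what
  is missing.\<close>

lemma sum_catalan:
  assumes p: "prime p" "p = 2 * m + 1" and y: "y = 16 * q"
  shows "[(\<Sum>k=0..p-1. catalan_int (2 * k) * q ^ k) =
    2 * odd_part (Suc m) y - q ^ m * even_part (Suc m) y] (mod int p)"
proof -
  have "p > 2" using p(2) prime_gt_1_nat[OF p(1)] by simp
  have "[(\<Sum>k<m. catalan_int (2 * k) * q ^ k) = (\<Sum>k<m. 2 * (-4) ^ (2 * k) * int (Suc m choose Suc (2 * k)) * q ^ k)] (mod int p)"
    using p by (intro cong_sum cong_scalar_right catalan_int_cong) auto
  also have "(\<Sum>k<m. 2 * (-4) ^ (2 * k) * int (Suc m choose Suc (2 * k)) * q ^ k) = 2 * odd_part (Suc m) y"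
    using p \<open>p > 2\<close>
    by (simp add: odd_part_upto[of "Suc m" m] y four_power_even power_mult_distrib
        sum_distrib_left mult.assoc mult.left_commute del: binomial_Suc_Suc)
  finally have "[(\<Sum>k<m. catalan_int (2 * k) * q ^ k) = 2 * odd_part (Suc m) y] (mod int p)" .
  from cong_add[OF this cong_scalar_right[OF catalan_int_prime_minus_one[OF p], of "q ^ m"]]
  have A: "[(\<Sum>k\<le>m. catalan_int (2 * k) * q ^ k) = 2 * odd_part (Suc m) y - q ^ m] (mod int p)"
    by (simp flip: lessThan_Suc_atMost)
  have "[(\<Sum>j<m. catalan_int (2 * (Suc m + j)) * q ^ (Suc m + j)) =
      (\<Sum>j<m. 2 * (2 * (-4) ^ (2 * j + 1) * int (Suc m choose Suc (2 * j + 1))) * q ^ (Suc m + j))] (mod int p)"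
  proof (intro cong_sum cong_scalar_right)
    fix j
    assume "j \<in> {..<m}"
    then have lt: "Suc (2 * j + 1) < p" using p by auto
    have "2 * (Suc m + j) = p + (2 * j + 1)" using p by auto
    then have "[catalan_int (2 * (Suc m + j)) = 2 * catalan_int (2 * j + 1)] (mod int p)"
      using catalan_int_add_prime[OF p(1) \<open>p > 2\<close> lt] by (simp only:)
    also have "[2 * catalan_int (2 * j + 1) = 2 * (2 * (-4) ^ (2 * j + 1) * int (Suc m choose Suc (2 * j + 1)))] (mod int p)"
      by (intro cong_scalar_left catalan_int_cong p lt)
    finally show "[catalan_int (2 * (Suc m + j)) = 2 * (2 * (-4) ^ (2 * j + 1) * int (Suc m choose Suc (2 * j + 1)))] (mod int p)" .
  qed
  also have "(\<Sum>j<m. 2 * (2 * (-4) ^ (2 * j + 1) * int (Suc m choose Suc (2 * j + 1))) * q ^ (Suc m + j)) =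
      - (q ^ m) * (\<Sum>j<m. int (Suc m choose (2 * Suc j)) * y ^ Suc j)"
    by (simp add: y four_power_even power_mult_distrib power_add sum_distrib_left
        mult.assoc mult.left_commute del: binomial_Suc_Suc flip: sum_negf)
  also have "(\<Sum>j<m. int (Suc m choose (2 * Suc j)) * y ^ Suc j) = even_part (Suc m) y - 1"
    by (simp add: even_part_upto[of "Suc m" m] lessThan_Suc_atMost[symmetric] sum.lessThan_Suc_shift
         del: binomial_Suc_Suc sum.lessThan_Suc)
  finally have B: "[(\<Sum>j<m. catalan_int (2 * (Suc m + j)) * q ^ (Suc m + j)) =
      - (q ^ m) * (even_part (Suc m) y - 1)] (mod int p)" .
  show ?thesis
    using cong_add[OF A B] unfolding sum_split_prime[OF p(2)]
    by (simp add: algebra_simps)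
qed

subsection \<open>Evaluation of the sums\<close>

text \<open>q represents c^2 / (64ab), and 64 and c^2 are squares, so q^m equals the m-th power of
  1/(ab), which is that of ab.\<close>

lemma ratio_power_half:
  assumes p: "prime p" "p = 2 * m + 1" and a: "\<not> int p dvd a" and b: "\<not> int p dvd b"
    and c: "\<not> int p dvd c" and q: "[64 * a * b * q = c\<^sup>2] (mod int p)"
  shows "[q ^ m = a ^ m * b ^ m] (mod int p)"
proof -
  have p8: "\<not> int p dvd 8"
    using odd_prime_not_dvd_power_two[OF p, of 3] by simp
  note sq = power_half_square[OF p]
  have "[(64 * a * b * q) ^ m = (c\<^sup>2) ^ m] (mod int p)"
    using q by (rule cong_pow)
  moreover have "(c\<^sup>2) ^ m = c ^ m * c ^ m"
    by (simp add: power_mult_distrib power2_eq_square)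
  ultimately have "[(64 * a * b * q) ^ m = 1] (mod int p)"
    using sq[OF c] cong_trans by metis
  from cong_mult[OF cong_refl[of "a ^ m * b ^ m"] this]
  have "[a ^ m * b ^ m * (64 * a * b * q) ^ m = a ^ m * b ^ m] (mod int p)" by simp
  moreover have "a ^ m * b ^ m * (64 * a * b * q) ^ m =
      (8 ^ m * 8 ^ m) * (a ^ m * a ^ m) * (b ^ m * b ^ m) * q ^ m"
    by (simp add: power_mult_distrib flip: power_mult_distrib[of 8 8])
  moreover have "[(8 ^ m * 8 ^ m) * (a ^ m * a ^ m) * (b ^ m * b ^ m) * q ^ m = 1 * 1 * 1 * q ^ m] (mod int p)"
    by (intro cong_mult sq p8 a b cong_refl)
  ultimately show ?thesis
    by (metis cong_sym cong_trans mult_1)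
qed

text \<open>With e = (a + b) / (2ab), both 16q and ab e^2 represent (a + b)^2 / (4ab), the argument
  at which the parts are known.\<close>

lemma ratio_parts_arg:
  assumes p: "prime p" "p = 2 * m + 1" and a: "\<not> int p dvd a" and b: "\<not> int p dvd b"
    and q: "[64 * a * b * q = (a + b)\<^sup>2] (mod int p)"
  obtains e where "[2 * a * b * e = a + b] (mod int p)" "[16 * q = a * b * e\<^sup>2] (mod int p)"
proof -
  have P: "prime (int p)" using p(1) by simp
  have "\<not> int p dvd 2"
    using odd_prime_not_dvd_power_two[OF p, of 1] by simp
  then have nd: "\<not> int p dvd 2 * a * b"
    using a b P by (simp add: prime_dvd_mult_iff)
  obtain u where u: "[2 * a * b * u = 1] (mod int p)"
    using inverse_mod_prime[OF p(1) nd] .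
  define e where "e = u * (a + b)"
  have e: "[2 * a * b * e = a + b] (mod int p)"
    using cong_scalar_right[OF u, of "a + b"] by (simp add: e_def mult.assoc)
  have "[(2 * a * b * e)\<^sup>2 = 64 * a * b * q] (mod int p)"
    using cong_trans[OF cong_pow[OF e] cong_sym[OF q]] .
  moreover have "(2 * a * b * e)\<^sup>2 = (2 * a * b) * (2 * (a * b * e\<^sup>2))"
    "64 * a * b * q = (2 * a * b) * (2 * (16 * q))"
    by (simp_all add: power2_eq_square)
  ultimately have "[(2 * a * b) * (2 * (a * b * e\<^sup>2)) = (2 * a * b) * (2 * (16 * q))] (mod int p)"
    by metis
  then have "[2 * (a * b * e\<^sup>2) = 2 * (16 * q)] (mod int p)"
    using cong_mult_lcancel[OF coprime_int_prime[OF p(1) nd]] by blast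
  then have "[a * b * e\<^sup>2 = 16 * q] (mod int p)"
    using cong_mult_lcancel[OF coprime_int_prime[OF p(1) \<open>\<not> int p dvd 2\<close>]] by blast
  with e that show ?thesis
    using cong_sym by blast
qed

lemma sum_catalan_parts:
  assumes p: "prime p" "p = 2 * m + 1" and a: "\<not> int p dvd a" and b: "\<not> int p dvd b"
    and c: "\<not> int p dvd a + b" and q: "[64 * a * b * q = (a + b)\<^sup>2] (mod int p)"
    and y: "[16 * q = y] (mod int p)"
  shows "[(\<Sum>k=0..p-1. catalan_int (2 * k) * q ^ k) =
    2 * odd_part (Suc m) y - a ^ m * b ^ m * even_part (Suc m) y] (mod int p)"
proof -
  have "[(\<Sum>k=0..p-1. catalan_int (2 * k) * q ^ k) =
      2 * odd_part (Suc m) (16 * q) - q ^ m * even_part (Suc m) (16 * q)] (mod int p)"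
    using sum_catalan[OF p refl] .
  also have "[2 * odd_part (Suc m) (16 * q) - q ^ m * even_part (Suc m) (16 * q) =
      2 * odd_part (Suc m) y - a ^ m * b ^ m * even_part (Suc m) y] (mod int p)"
    by (intro cong_diff cong_mult cong_refl odd_part_cong even_part_cong y
        ratio_power_half[OF p a b c q])
  finally show ?thesis .
qed

lemma sum_catalan_even:
  assumes p: "prime p" "p = 2 * m + 1" and a: "\<not> int p dvd a" and b: "\<not> int p dvd b"
    and c: "\<not> int p dvd a + b" and q: "[64 * a * b * q = (a + b)\<^sup>2] (mod int p)"
    and h: "m = 2 * h"
  shows "[2 * (a + b) * (\<Sum>k=0..p-1. catalan_int (2 * k) * q ^ k) =
    2 ^ m * (a * b) ^ h * ((3 * a - b) * b ^ m + (3 * b - a) * a ^ m)] (mod int p)"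
proof -
  obtain e where e: "[2 * a * b * e = a + b] (mod int p)" and y: "[16 * q = a * b * e\<^sup>2] (mod int p)"
    using ratio_parts_arg[OF p a b q] .
  define P \<alpha> \<beta> \<delta> r E D S where
    defs: "P = int p" "\<alpha> = a ^ m" "\<beta> = b ^ m" "\<delta> = (2::int) ^ m" "r = (a * b) ^ h"
    "E = even_part (Suc m) (a * b * e\<^sup>2)" "D = odd_part (Suc m) (a * b * e\<^sup>2)"
    "S = (\<Sum>k=0..p-1. catalan_int (2 * k) * q ^ k)"
  have S: "P dvd S - (2 * D - \<alpha> * \<beta> * E)"
    using sum_catalan_parts[OF p a b c q y] by (simp add: cong_iff_dvd_diff defs)
  have H: "P dvd 2 * E - \<delta> * r * (\<alpha> + \<beta>)" "P dvd (a + b) * D - \<delta> * r * (a * \<beta> + b * \<alpha>)"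
    using parts_cong_even[OF p a b e h] by (simp_all add: cong_iff_dvd_diff defs)
  have A: "P dvd \<alpha> * \<alpha> - 1" "P dvd \<beta> * \<beta> - 1"
    using power_half_square[OF p a] power_half_square[OF p b] by (simp_all add: cong_iff_dvd_diff defs)
  \<comment> \<open>A combination that eliminates \<open>D\<close> and \<open>E\<close>; the last
    line uses \<alpha>^2 = \<beta>^2 = 1 to turn \<alpha>\<beta>(\<alpha> + \<beta>) into \<alpha> +
    \<beta>.\<close>
  have "P dvd 2 * (a + b) * (S - (2 * D - \<alpha> * \<beta> * E))
      + 4 * ((a + b) * D - \<delta> * r * (a * \<beta> + b * \<alpha>))
      - (a + b) * \<alpha> * \<beta> * (2 * E - \<delta> * r * (\<alpha> + \<beta>))
      - \<delta> * r * (a + b) * (\<beta> * (\<alpha> * \<alpha> - 1) + \<alpha> * (\<beta> * \<beta> - 1))"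
    by (intro dvd_add dvd_diff dvd_mult S H A)
  also have "\<dots> = 2 * (a + b) * S - \<delta> * r * ((3 * a - b) * \<beta> + (3 * b - a) * \<alpha>)"
    by (simp add: algebra_simps)
  finally show ?thesis
    by (simp add: cong_iff_dvd_diff defs)
qed

lemma sum_catalan_odd:
  assumes p: "prime p" "p = 2 * m + 1" and a: "\<not> int p dvd a" and b: "\<not> int p dvd b"
    and c: "\<not> int p dvd a + b" and q: "[64 * a * b * q = (a + b)\<^sup>2] (mod int p)"
    and h: "Suc m = 2 * h"
  shows "[2 * (a + b) * (a * b) * (\<Sum>k=0..p-1. catalan_int (2 * k) * q ^ k) =
    2 ^ m * (a * b) ^ h * (b * (3 * a - b) * b ^ m + a * (3 * b - a) * a ^ m)] (mod int p)"
proof -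
  obtain e where e: "[2 * a * b * e = a + b] (mod int p)" and y: "[16 * q = a * b * e\<^sup>2] (mod int p)"
    using ratio_parts_arg[OF p a b q] .
  define P \<alpha> \<beta> \<delta> r E D S where
    defs: "P = int p" "\<alpha> = a ^ m" "\<beta> = b ^ m" "\<delta> = (2::int) ^ m" "r = (a * b) ^ h"
    "E = even_part (Suc m) (a * b * e\<^sup>2)" "D = odd_part (Suc m) (a * b * e\<^sup>2)"
    "S = (\<Sum>k=0..p-1. catalan_int (2 * k) * q ^ k)"
  have S: "P dvd S - (2 * D - \<alpha> * \<beta> * E)"
    using sum_catalan_parts[OF p a b c q y] by (simp add: cong_iff_dvd_diff defs)
  have H: "P dvd 2 * a * b * E - \<delta> * r * (a * \<beta> + b * \<alpha>)" "P dvd (a + b) * D - \<delta> * r * (\<alpha> + \<beta>)"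
    using parts_cong_odd[OF p a b e h] by (simp_all add: cong_iff_dvd_diff defs)
  have A: "P dvd \<alpha> * \<alpha> - 1" "P dvd \<beta> * \<beta> - 1"
    using power_half_square[OF p a] power_half_square[OF p b] by (simp_all add: cong_iff_dvd_diff defs)
  \<comment> \<open>The additional factor ab is forced by \<open>parts_cong_odd\<close>, which knows
    \<open>E\<close> only through 2ab \<open>E\<close>.\<close>
  have "P dvd 2 * (a + b) * (a * b) * (S - (2 * D - \<alpha> * \<beta> * E))
      + 4 * a * b * ((a + b) * D - \<delta> * r * (\<alpha> + \<beta>))
      - (a + b) * \<alpha> * \<beta> * (2 * a * b * E - \<delta> * r * (a * \<beta> + b * \<alpha>))
      - \<delta> * r * (a + b) * (a * \<alpha> * (\<beta> * \<beta> - 1) + b * \<beta> * (\<alpha> * \<alpha> - 1))"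
    by (intro dvd_add dvd_diff dvd_mult S H A)
  also have "\<dots> = 2 * (a + b) * (a * b) * S
      - \<delta> * r * (b * (3 * a - b) * \<beta> + a * (3 * b - a) * \<alpha>)"
    by (simp add: algebra_simps)
  finally show ?thesis
    by (simp add: cong_iff_dvd_diff defs)
qed

text \<open>\<open>sum_central\<close> has exponent m, whereas the parts are evaluated at
  \<open>Suc m\<close>. Going back divides by 1 + sqrt y, whose norm 1 - y is -(a - b)^2 / (4ab);
  this explains the factor (a - b)^2.\<close>

lemma sum_central_parts:
  assumes p: "prime p" "p = 2 * m + 1" and a: "\<not> int p dvd a" and b: "\<not> int p dvd b"
    and q: "[64 * a * b * q = (a + b)\<^sup>2] (mod int p)"
    and y: "[16 * q = y] (mod int p)"
  shows "[4 * (a - b)\<^sup>2 * (\<Sum>k=0..p-1. int (central (2 * k)) * q ^ k) =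
    2 * (a + b) * (2 + a ^ m * b ^ m) * ((a + b) * odd_part (Suc m) y)
    - 2 * even_part (Suc m) y * (8 * a * b + a ^ m * b ^ m * (a + b)\<^sup>2)] (mod int p)"
proof -
  have P: "prime (int p)" using p(1) by simp
  have "[q ^ m * (16 * q) = a ^ m * b ^ m * (16 * q)] (mod int p)"
  \<comment> \<open>\<open>ratio_power_half\<close> requires a + b to be invertible. Otherwise q is
    0 modulo p, and the factor 16q makes both sides vanish.\<close>
  proof (cases "int p dvd a + b")
    case True
    have "\<not> int p dvd 64"
      using odd_prime_not_dvd_power_two[OF p, of 6] by simp
    moreover have "int p dvd 64 * a * b * q"
      using True cong_dvd_iff[OF q] by (simp add: dvd_power_le power2_eq_square)
    ultimately have "int p dvd q"
      using a b P by (simp add: prime_dvd_mult_iff)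
    then show ?thesis
      by (simp add: cong_iff_dvd_diff flip: left_diff_distrib)
  next
    case False
    then show ?thesis
      by (intro cong_scalar_right ratio_power_half[OF p a b _ q])
  qed
  then have qm: "[q ^ m * (16 * q) = a ^ m * b ^ m * y] (mod int p)"
    using cong_scalar_left[OF y, of "a ^ m * b ^ m"] cong_trans by blast
  have "[4 * a * b * (16 * q) = 4 * a * b * y] (mod int p)"
    using y by (rule cong_scalar_left)
  then have "[4 * a * b * y = (a + b)\<^sup>2] (mod int p)"
    using q by (simp add: mult_ac) (metis cong_sym cong_trans)
  then have Y: "int p dvd 4 * a * b * y - (a + b)\<^sup>2"
    by (simp add: cong_iff_dvd_diff)
  define l E D S where
    defs: "l = a ^ m * b ^ m" "E = even_part m y" "D = odd_part m y"
    "S = (\<Sum>k=0..p-1. int (central (2 * k)) * q ^ k)"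
  have "[2 * S = 2 * even_part m (16 * q) - q ^ m * (16 * q) * odd_part m (16 * q)] (mod int p)"
    using sum_central[OF p refl] by (simp add: defs)
  also have "[2 * even_part m (16 * q) - q ^ m * (16 * q) * odd_part m (16 * q) =
      2 * E - l * y * D] (mod int p)"
    unfolding defs by (intro cong_diff cong_mult[OF cong_refl] cong_mult[OF qm] even_part_cong odd_part_cong y)
  finally have T: "int p dvd 2 * S - (2 * E - l * y * D)"
    by (simp add: cong_iff_dvd_diff)
  have "int p dvd 2 * (a - b)\<^sup>2 * (2 * S - (2 * E - l * y * D))
      - 2 * (2 * E - l * y * D) * (4 * a * b * y - (a + b)\<^sup>2)
      + 2 * (2 * (E + D) - l * (E + y * D) + l * (E + D)) * (4 * a * b * y - (a + b)\<^sup>2)"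
    by (intro dvd_add dvd_diff dvd_mult T Y)
  also have "\<dots> = 4 * (a - b)\<^sup>2 * S - (2 * (a + b) * (2 + l) * ((a + b) * (E + D))
      - 2 * (E + y * D) * (8 * a * b + l * (a + b)\<^sup>2))"
    by (simp add: algebra_simps power2_eq_square)
  finally show ?thesis
    by (simp add: cong_iff_dvd_diff defs even_part_Suc odd_part_Suc)
qed

text \<open>After elimination of the two parts, the coefficients of \<beta> and \<alpha> are (3a -
  b)(a - b) and (3b - a)(b - a), so one of the two factors a - b cancels.\<close>

lemma sum_central_even:
  assumes p: "prime p" "p = 2 * m + 1" and a: "\<not> int p dvd a" and b: "\<not> int p dvd b"
    and c: "\<not> int p dvd a - b" and q: "[64 * a * b * q = (a + b)\<^sup>2] (mod int p)"
    and h: "m = 2 * h"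
  shows "[4 * (a - b) * (\<Sum>k=0..p-1. int (central (2 * k)) * q ^ k) =
    2 ^ m * (a * b) ^ h * ((3 * a - b) * b ^ m - (3 * b - a) * a ^ m)] (mod int p)"
proof -
  obtain e where e: "[2 * a * b * e = a + b] (mod int p)" and y: "[16 * q = a * b * e\<^sup>2] (mod int p)"
    using ratio_parts_arg[OF p a b q] .
  define P \<alpha> \<beta> \<delta> r E D S where
    defs: "P = int p" "\<alpha> = a ^ m" "\<beta> = b ^ m" "\<delta> = (2::int) ^ m" "r = (a * b) ^ h"
    "E = even_part (Suc m) (a * b * e\<^sup>2)" "D = odd_part (Suc m) (a * b * e\<^sup>2)"
    "S = (\<Sum>k=0..p-1. int (central (2 * k)) * q ^ k)"
  define K where "K = 4 * (a - b)\<^sup>2 * S - (2 * (a + b) * (2 + \<alpha> * \<beta>) * ((a + b) * D)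
      - 2 * E * (8 * a * b + \<alpha> * \<beta> * (a + b)\<^sup>2))"
  have K: "P dvd K"
    using sum_central_parts[OF p a b q y] by (simp add: cong_iff_dvd_diff defs K_def)
  have H: "P dvd 2 * E - \<delta> * r * (\<alpha> + \<beta>)" "P dvd (a + b) * D - \<delta> * r * (a * \<beta> + b * \<alpha>)"
    using parts_cong_even[OF p a b e h] by (simp_all add: cong_iff_dvd_diff defs)
  have A: "P dvd \<alpha> * \<alpha> - 1" "P dvd \<beta> * \<beta> - 1"
    using power_half_square[OF p a] power_half_square[OF p b] by (simp_all add: cong_iff_dvd_diff defs)
  have "P dvd K + 2 * (a + b) * (2 + \<alpha> * \<beta>) * ((a + b) * D - \<delta> * r * (a * \<beta> + b * \<alpha>))
      - (8 * a * b + \<alpha> * \<beta> * (a + b)\<^sup>2) * (2 * E - \<delta> * r * (\<alpha> + \<beta>))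
      + \<delta> * r * (2 * (a + b) * (a * \<alpha> * (\<beta> * \<beta> - 1) + b * \<beta> * (\<alpha> * \<alpha> - 1))
        - (a + b)\<^sup>2 * (\<beta> * (\<alpha> * \<alpha> - 1) + \<alpha> * (\<beta> * \<beta> - 1)))"
    by (intro dvd_add dvd_diff dvd_mult K H A)
  also have "\<dots> = (a - b) * (4 * (a - b) * S - \<delta> * r * ((3 * a - b) * \<beta> - (3 * b - a) * \<alpha>))"
    unfolding K_def by (simp add: algebra_simps power2_eq_square)
  finally have "P dvd (a - b) * (4 * (a - b) * S - \<delta> * r * ((3 * a - b) * \<beta> - (3 * b - a) * \<alpha>))" .
  moreover have "prime P"
    using p(1) by (simp add: defs)
  ultimately have "P dvd 4 * (a - b) * S - \<delta> * r * ((3 * a - b) * \<beta> - (3 * b - a) * \<alpha>)"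
    using c[folded defs(1)] by (simp only: prime_dvd_mult_iff) simp
  then show ?thesis
    by (simp add: cong_iff_dvd_diff defs)
qed

lemma sum_central_odd:
  assumes p: "prime p" "p = 2 * m + 1" and a: "\<not> int p dvd a" and b: "\<not> int p dvd b"
    and c: "\<not> int p dvd a - b" and q: "[64 * a * b * q = (a + b)\<^sup>2] (mod int p)"
    and h: "Suc m = 2 * h"
  shows "[4 * (b - a) * (a * b) * (\<Sum>k=0..p-1. int (central (2 * k)) * q ^ k) =
    2 ^ m * (a * b) ^ h * (b * (3 * a - b) * b ^ m - a * (3 * b - a) * a ^ m)] (mod int p)"
proof -
  obtain e where e: "[2 * a * b * e = a + b] (mod int p)" and y: "[16 * q = a * b * e\<^sup>2] (mod int p)"
    using ratio_parts_arg[OF p a b q] .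
  define P \<alpha> \<beta> \<delta> r E D S where
    defs: "P = int p" "\<alpha> = a ^ m" "\<beta> = b ^ m" "\<delta> = (2::int) ^ m" "r = (a * b) ^ h"
    "E = even_part (Suc m) (a * b * e\<^sup>2)" "D = odd_part (Suc m) (a * b * e\<^sup>2)"
    "S = (\<Sum>k=0..p-1. int (central (2 * k)) * q ^ k)"
  define K where "K = 4 * (a - b)\<^sup>2 * S - (2 * (a + b) * (2 + \<alpha> * \<beta>) * ((a + b) * D)
      - 2 * E * (8 * a * b + \<alpha> * \<beta> * (a + b)\<^sup>2))"
  have K: "P dvd K"
    using sum_central_parts[OF p a b q y] by (simp add: cong_iff_dvd_diff defs K_def)
  have H: "P dvd 2 * a * b * E - \<delta> * r * (a * \<beta> + b * \<alpha>)" "P dvd (a + b) * D - \<delta> * r * (\<alpha> + \<beta>)"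
    using parts_cong_odd[OF p a b e h] by (simp_all add: cong_iff_dvd_diff defs)
  have A: "P dvd \<alpha> * \<alpha> - 1" "P dvd \<beta> * \<beta> - 1"
    using power_half_square[OF p a] power_half_square[OF p b] by (simp_all add: cong_iff_dvd_diff defs)
  have "P dvd a * b * K + 2 * (a + b) * (2 + \<alpha> * \<beta>) * (a * b) * ((a + b) * D - \<delta> * r * (\<alpha> + \<beta>))
      - (8 * a * b + \<alpha> * \<beta> * (a + b)\<^sup>2) * (2 * a * b * E - \<delta> * r * (a * \<beta> + b * \<alpha>))
      + \<delta> * r * (2 * (a + b) * (a * b) * (\<beta> * (\<alpha> * \<alpha> - 1) + \<alpha> * (\<beta> * \<beta> - 1))
        - (a + b)\<^sup>2 * (a * \<alpha> * (\<beta> * \<beta> - 1) + b * \<beta> * (\<alpha> * \<alpha> - 1)))"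
    by (intro dvd_add dvd_diff dvd_mult K H A)
  \<comment> \<open>The minus sign turns the remaining factor a - b into the b - a of the
    claim.\<close>
  also have "\<dots> = (a - b) *
      - (4 * (b - a) * (a * b) * S - \<delta> * r * (b * (3 * a - b) * \<beta> - a * (3 * b - a) * \<alpha>))"
    unfolding K_def by (simp add: algebra_simps power2_eq_square)
  finally have "P dvd (a - b) *
      - (4 * (b - a) * (a * b) * S - \<delta> * r * (b * (3 * a - b) * \<beta> - a * (3 * b - a) * \<alpha>))" .
  moreover have "prime P"
    using p(1) by (simp add: defs)
  ultimately have "P dvd 4 * (b - a) * (a * b) * S - \<delta> * r * (b * (3 * a - b) * \<beta> - a * (3 * b - a) * \<alpha>)"
    using c[folded defs(1)] by (simp only: prime_dvd_mult_iff dvd_minus_iff) simp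
  then show ?thesis
    by (simp add: cong_iff_dvd_diff defs)
qed

subsection \<open>Congruences of rational numbers\<close>

text \<open>The denominator of a reduced fraction divides every integer that clears it, so one
  multiplier prime to p suffices.\<close>

lemma denom_prime_toI:
  assumes "coprime d (int p)" "of_int d * x = of_int n"
  shows "denom_prime_to p x"
proof -
  obtain u v where uv: "quotient_of x = (u, v)" by force
  then have x: "x = of_int u / of_int v" and v: "v > 0" and co: "coprime u v"
    using quotient_of_div quotient_of_denom_pos quotient_of_coprime by auto
  have "of_int (d * u) = (of_int (n * v) :: rat)"
    using assms(2) v by (simp add: x field_simps)
  then have "d * u = n * v"
    by (simp only: of_int_eq_iff)
  then have "v dvd d * u"
    by simp
  then have "v dvd d"
    using co by (simp add: coprime_commute coprime_dvd_mult_left_iff)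
  then show ?thesis
    using coprime_divisors[OF _ dvd_refl assms(1)] uv by (simp add: denom_prime_to_def)
qed

lemma rat_congI:
  assumes d: "coprime d (int p)" "of_int d * x = of_int n"
    and e: "coprime e (int p)" "of_int e * y = of_int k"
    and cong: "[n * e = k * d] (mod int p)"
  shows "rat_cong p x y"
proof -
  obtain u v where uv: "quotient_of (x - y) = (u, v)" by force
  then have xy: "x - y = of_int u / of_int v" and v: "v > 0"
    using quotient_of_div quotient_of_denom_pos by auto
  have "of_int (d * e * u) = of_int (d * e) * (x - y) * of_int v"
    using v by (simp add: xy)
  also have "of_int (d * e) * (x - y) = (of_int d * x) * of_int e - (of_int e * y) * of_int d"
    by (simp add: algebra_simps)
  also have "\<dots> * of_int v = of_int ((n * e - k * d) * v)"
    unfolding d(2) e(2) by simp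
  finally have "d * e * u = (n * e - k * d) * v"
    by (simp only: of_int_eq_iff)
  moreover have "int p dvd n * e - k * d"
    using cong by (simp add: cong_iff_dvd_diff)
  ultimately have "int p dvd d * e * u"
    by simp
  moreover have "coprime (d * e) (int p)"
    using d(1) e(1) by simp
  ultimately have "int p dvd u"
    by (simp add: coprime_commute coprime_dvd_mult_right_iff)
  then show ?thesis
    using denom_prime_toI[OF d] denom_prime_toI[OF e] uv by (simp add: rat_cong_def)
qed

text \<open>Bridge from integers to rationals: modulo p the ratio N / D becomes the integer
  \<open>N * w\<close>, while \<open>D ^ (p - 1)\<close> clears all denominators of the sum. The
  free \<open>k\<close> is the integer value of e y, unrelated to the summation index.\<close>

lemma rat_cong_sumI:
  assumes p: "prime p" and D: "\<not> int p dvd D" and w: "[D * w = 1] (mod int p)"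
    and e: "\<not> int p dvd e" "of_int e * y = of_int k"
    and cong: "[e * (\<Sum>k=0..p-1. g k * (N * w) ^ k) = k] (mod int p)"
  shows "rat_cong p (\<Sum>k=0..p-1. of_int (g k) * (of_int N ^ k / of_int D ^ k)) y"
proof (rule rat_congI)
  let ?n = "\<Sum>k=0..p-1. g k * N ^ k * D ^ (p - 1 - k)"
  show "coprime (D ^ (p - 1)) (int p)"
    using coprime_int_prime[OF p D] by simp
  show "of_int (D ^ (p - 1)) * (\<Sum>k=0..p-1. of_int (g k) * (of_int N ^ k / of_int D ^ k)) = (of_int ?n :: rat)"
    unfolding sum_distrib_left of_int_sum
  proof (rule sum.cong)
    fix k
    assume "k \<in> {0..p-1}"
    then have "D ^ (p - 1) = D ^ k * D ^ (p - 1 - k)"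
      by (metis atLeastAtMost_iff le_add_diff_inverse power_add)
    moreover have "D \<noteq> 0"
      using D by auto
    ultimately show "of_int (D ^ (p - 1)) * (of_int (g k) * (of_int N ^ k / of_int D ^ k)) =
        (of_int (g k * N ^ k * D ^ (p - 1 - k)) :: rat)"
      by simp
  qed simp
  show "coprime e (int p)"
    using coprime_int_prime[OF p e(1)] .
  show "of_int e * y = of_int k"
    by fact
  have "[?n = (\<Sum>k=0..p-1. D ^ (p - 1) * (g k * (N * w) ^ k))] (mod int p)"
  proof (rule cong_sum)
    fix k
    assume "k \<in> {0..p-1}"
    then have "D ^ (p - 1) = D ^ k * D ^ (p - 1 - k)"
      by (metis atLeastAtMost_iff le_add_diff_inverse power_add)
    then have eq: "(D * w) ^ k * (g k * N ^ k * D ^ (p - 1 - k)) = D ^ (p - 1) * (g k * (N * w) ^ k)"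
      by (simp add: power_mult_distrib)
    have "[(D * w) ^ k * (g k * N ^ k * D ^ (p - 1 - k)) = 1 ^ k * (g k * N ^ k * D ^ (p - 1 - k))] (mod int p)"
      using w by (intro cong_scalar_right cong_pow)
    then show "[g k * N ^ k * D ^ (p - 1 - k) = D ^ (p - 1) * (g k * (N * w) ^ k)] (mod int p)"
      unfolding eq by (simp add: cong_sym)
  qed
  then have "[?n = D ^ (p - 1) * (\<Sum>k=0..p-1. g k * (N * w) ^ k)] (mod int p)"
    by (simp add: sum_distrib_left)
  from cong_scalar_right[OF this, of e]
  have "[?n * e = D ^ (p - 1) * (e * (\<Sum>k=0..p-1. g k * (N * w) ^ k))] (mod int p)"
    by (simp add: mult_ac)
  also have "[D ^ (p - 1) * (e * (\<Sum>k=0..p-1. g k * (N * w) ^ k)) = D ^ (p - 1) * k] (mod int p)"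
    using cong by (rule cong_scalar_left)
  finally show "[?n * e = k * D ^ (p - 1)] (mod int p)"
    by (simp add: mult.commute)
qed

section \<open>Assembly of the four congruences\<close>

theorem theorem10:
  fixes p :: nat and a b :: int
  assumes "prime p" and "p > 3"
    and "[a * b \<noteq> 0] (mod int p)"
    and "[a \<noteq> b] (mod int p)"
  defines "A \<equiv> rat_of_int a" and "B \<equiv> rat_of_int b"
    and "L \<equiv> (\<lambda>x. rat_of_int (Legendre x (int p)))"
  shows
    "([p = 1] (mod 4) \<longrightarrow>
        rat_cong p
          (\<Sum>k=0..p-1. catalan (2*k) * ((A - B) ^ (2*k) / (- 64 * A * B) ^ k))
          ((A * B) ^ ((p - 1) div 4) / (2 * (A - B))
             * ((3 * A + B) * L b - (3 * B + A) * L a))) \<and>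
     ([p = 3] (mod 4) \<longrightarrow>
        rat_cong p
          (\<Sum>k=0..p-1. catalan (2*k) * ((A - B) ^ (2*k) / (- 64 * A * B) ^ k))
          ((A * B) ^ ((p + 1) div 4) / (2 * (B - A))
             * ((3 * A + B) / A * L b - (3 * B + A) / B * L a))) \<and>
     ([p = 1] (mod 4) \<longrightarrow>
        rat_cong p
          (\<Sum>k=0..p-1. of_nat ((4*k) choose (2*k)) * ((A + B) ^ (2*k) / (64 * A * B) ^ k))
          (L 2 * (A * B) ^ ((p - 1) div 4) / (4 * (A - B))
             * ((3 * A - B) * L b - (3 * B - A) * L a))) \<and>
     ([p = 3] (mod 4) \<longrightarrow>
        rat_cong p
          (\<Sum>k=0..p-1. of_nat ((4*k) choose (2*k)) * ((A + B) ^ (2*k) / (64 * A * B) ^ k))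
          (L 2 * (A * B) ^ ((p + 1) div 4) / (4 * (B - A))
             * ((3 * A - B) / A * L b - (3 * B - A) / B * L a)))"
proof -
  define m where "m = (p - 1) div 2"
  have pm: "p = 2 * m + 1"
    using prime_odd_nat[OF \<open>prime p\<close>] \<open>p > 3\<close> by (auto simp: m_def elim!: oddE)
  note p = \<open>prime p\<close> pm
  have P: "prime (int p)" using p(1) by simp
  have a: "\<not> int p dvd a" and b: "\<not> int p dvd b" and nb: "\<not> int p dvd - b"
    using assms(3) by (auto simp: cong_0_iff)
  have ab: "\<not> int p dvd a - b" and ba: "\<not> int p dvd b - a" and nab: "\<not> int p dvd a + - b"
    using assms(4) by (auto simp: cong_iff_dvd_diff dvd_diff_commute)
  have p2: "\<not> int p dvd 2" and p4: "\<not> int p dvd 4"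
    and p64: "\<not> int p dvd 64" "\<not> int p dvd - 64"
    using odd_prime_not_dvd_power_two[OF p, of 1] odd_prime_not_dvd_power_two[OF p, of 2]
      odd_prime_not_dvd_power_two[OF p, of 6] by simp_all
  have D1: "\<not> int p dvd - 64 * a * b" and D2: "\<not> int p dvd 64 * a * b"
    using p64 a b P by (simp_all only: prime_dvd_mult_iff) simp_all
  obtain w1 where w1: "[- 64 * a * b * w1 = 1] (mod int p)"
    using inverse_mod_prime[OF p(1) D1] .
  obtain w2 where w2: "[64 * a * b * w2 = 1] (mod int p)"
    using inverse_mod_prime[OF p(1) D2] .
  define q1 where "q1 = (a - b)\<^sup>2 * w1"
  define q2 where "q2 = (a + b)\<^sup>2 * w2"
  \<comment> \<open>The Catalan sum is the instance with \<open>- b\<close> in place of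
    \<open>b\<close>, for which a + b becomes a - b.\<close>
  have q1: "[64 * a * (- b) * q1 = (a + - b)\<^sup>2] (mod int p)"
    using cong_scalar_right[OF w1, of "(a - b)\<^sup>2"] by (simp add: q1_def mult_ac)
  have q2: "[64 * a * b * q2 = (a + b)\<^sup>2] (mod int p)"
    using cong_scalar_right[OF w2, of "(a + b)\<^sup>2"] by (simp add: q2_def mult_ac)
  note Leg = cong_sym[OF Legendre_cong_power[OF p]]
  have nz: "A \<noteq> 0" "B \<noteq> 0" "A - B \<noteq> 0" "B - A \<noteq> 0"
    using a b ab by (auto simp: A_def B_def)
  have sum1: "(\<Sum>k=0..p-1. catalan (2*k) * ((A - B) ^ (2*k) / (- 64 * A * B) ^ k)) =
      (\<Sum>k=0..p-1. of_int (catalan_int (2 * k)) * (of_int ((a - b)\<^sup>2) ^ k / of_int (- 64 * a * b) ^ k))"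
    by (simp add: catalan_eq_int A_def B_def power_mult)
  have sum2: "(\<Sum>k=0..p-1. of_nat ((4*k) choose (2*k)) * ((A + B) ^ (2*k) / (64 * A * B) ^ k)) =
      (\<Sum>k=0..p-1. of_int (int (central (2 * k))) * (of_int ((a + b)\<^sup>2) ^ k / of_int (64 * a * b) ^ k))"
    by (simp add: central_def A_def B_def power_mult)
  show ?thesis
  proof (intro conjI impI)
    assume "[p = 1] (mod 4)"
    then have "even m"
      using pm unfolding cong_def by presburger
    then obtain h where h: "m = 2 * h" "(p - 1) div 4 = h"
      using pm by (auto elim!: evenE)
    have m: "(- b) ^ m = b ^ m" using h by simp
    show "rat_cong p (\<Sum>k=0..p-1. catalan (2*k) * ((A - B) ^ (2*k) / (- 64 * A * B) ^ k))
        ((A * B) ^ ((p - 1) div 4) / (2 * (A - B)) * ((3 * A + B) * L b - (3 * B + A) * L a))"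
      unfolding sum1 h(2)
    proof (rule rat_cong_sumI[OF p(1) D1 w1])
      show "\<not> int p dvd 2 * (a - b)"
        using p2 ab P by (simp only: prime_dvd_mult_iff) simp
      show "of_int (2 * (a - b)) * ((A * B) ^ h / (2 * (A - B)) * ((3 * A + B) * L b - (3 * B + A) * L a)) =
          of_int ((a * b) ^ h * ((3 * a + b) * Legendre b (int p) - (3 * b + a) * Legendre a (int p)))"
        using nz by (simp add: A_def B_def L_def)
      have "[2 * (a + - b) * (\<Sum>k=0..p-1. catalan_int (2 * k) * q1 ^ k) =
          2 ^ m * (a * - b) ^ h * ((3 * a - - b) * (- b) ^ m + (3 * - b - a) * a ^ m)] (mod int p)"
        by (rule sum_catalan_even[OF p a nb nab q1 h(1)])
      \<comment> \<open>The sign (-1)^h from (-ab)^h meets 2^m, which is also (-1)^h modulo p. They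
        cancel, so no symbol of 2 appears in the Catalan case.\<close>
      also have "2 ^ m * (a * - b) ^ h * ((3 * a - - b) * (- b) ^ m + (3 * - b - a) * a ^ m) =
          (2 ^ m * (-1) ^ h) * ((a * b) ^ h * ((3 * a + b) * b ^ m - (3 * b + a) * a ^ m))"
        unfolding m power_minus[of "a * b"] mult_minus_right by (simp add: algebra_simps)
      also have "[(2 ^ m * (-1) ^ h) * ((a * b) ^ h * ((3 * a + b) * b ^ m - (3 * b + a) * a ^ m)) =
          ((-1) ^ h * (-1) ^ h) * ((a * b) ^ h *
            ((3 * a + b) * Legendre b (int p) - (3 * b + a) * Legendre a (int p)))] (mod int p)"
        by (intro cong_mult cong_diff cong_refl Leg two_power_half_even[OF p h(1)])
      also have "(-1) ^ h * (-1) ^ h = (1 :: int)"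
        by (simp flip: power_mult_distrib)
      finally show "[2 * (a - b) * (\<Sum>k=0..p-1. catalan_int (2 * k) * ((a - b)\<^sup>2 * w1) ^ k) =
          (a * b) ^ h * ((3 * a + b) * Legendre b (int p) - (3 * b + a) * Legendre a (int p))] (mod int p)"
        by (simp add: q1_def)
    qed
    show "rat_cong p (\<Sum>k=0..p-1. of_nat ((4*k) choose (2*k)) * ((A + B) ^ (2*k) / (64 * A * B) ^ k))
        (L 2 * (A * B) ^ ((p - 1) div 4) / (4 * (A - B)) * ((3 * A - B) * L b - (3 * B - A) * L a))"
      unfolding sum2 h(2)
    proof (rule rat_cong_sumI[OF p(1) D2 w2])
      show "\<not> int p dvd 4 * (a - b)"
        using p4 ab P by (simp only: prime_dvd_mult_iff) simp
      show "of_int (4 * (a - b)) * (L 2 * (A * B) ^ h / (4 * (A - B)) * ((3 * A - B) * L b - (3 * B - A) * L a)) =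
          of_int (Legendre 2 (int p) * (a * b) ^ h *
            ((3 * a - b) * Legendre b (int p) - (3 * b - a) * Legendre a (int p)))"
        using nz by (simp add: A_def B_def L_def)
      have "[4 * (a - b) * (\<Sum>k=0..p-1. int (central (2 * k)) * q2 ^ k) =
          2 ^ m * (a * b) ^ h * ((3 * a - b) * b ^ m - (3 * b - a) * a ^ m)] (mod int p)"
        by (rule sum_central_even[OF p a b ab q2 h(1)])
      \<comment> \<open>Without the change of sign of \<open>b\<close>, 2^m survives and becomes the
        Legendre symbol of 2.\<close>
      also have "[2 ^ m * (a * b) ^ h * ((3 * a - b) * b ^ m - (3 * b - a) * a ^ m) =
          Legendre 2 (int p) * (a * b) ^ h *
            ((3 * a - b) * Legendre b (int p) - (3 * b - a) * Legendre a (int p))] (mod int p)"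
        by (intro cong_mult cong_diff cong_refl Leg)
      finally show "[4 * (a - b) * (\<Sum>k=0..p-1. int (central (2 * k)) * ((a + b)\<^sup>2 * w2) ^ k) =
          Legendre 2 (int p) * (a * b) ^ h *
            ((3 * a - b) * Legendre b (int p) - (3 * b - a) * Legendre a (int p))] (mod int p)"
        by (simp add: q2_def)
    qed
  next
    assume "[p = 3] (mod 4)"
    then have "odd m"
      using pm unfolding cong_def by presburger
    then obtain j where "m = 2 * j + 1"
      by (rule oddE)
    then obtain h where h: "Suc m = 2 * h" "(p + 1) div 4 = h"
      using pm that[of "Suc j"] by simp
    from \<open>odd m\<close> have m: "(- b) ^ m = - (b ^ m)" by simp
    show "rat_cong p (\<Sum>k=0..p-1. catalan (2*k) * ((A - B) ^ (2*k) / (- 64 * A * B) ^ k))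
        ((A * B) ^ ((p + 1) div 4) / (2 * (B - A)) * ((3 * A + B) / A * L b - (3 * B + A) / B * L a))"
      unfolding sum1 h(2)
    proof (rule rat_cong_sumI[OF p(1) D1 w1])
      \<comment> \<open>The multiplier contains ab as well, to clear the inner denominators
        \<open>A\<close> and \<open>B\<close>.\<close>
      show "\<not> int p dvd 2 * (b - a) * (a * b)"
        using p2 ba a b P by (simp only: prime_dvd_mult_iff) simp
      show "of_int (2 * (b - a) * (a * b)) *
            ((A * B) ^ h / (2 * (B - A)) * ((3 * A + B) / A * L b - (3 * B + A) / B * L a)) =
          of_int ((a * b) ^ h * (b * (3 * a + b) * Legendre b (int p) - a * (3 * b + a) * Legendre a (int p)))"
        using nz by (simp add: L_def field_simps flip: A_def B_def)
      have "[2 * (a + - b) * (a * - b) * (\<Sum>k=0..p-1. catalan_int (2 * k) * q1 ^ k) =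
          2 ^ m * (a * - b) ^ h * (- b * (3 * a - - b) * (- b) ^ m + a * (3 * - b - a) * a ^ m)] (mod int p)"
        by (rule sum_catalan_odd[OF p a nb nab q1 h(1)])
      also have "2 ^ m * (a * - b) ^ h * (- b * (3 * a - - b) * (- b) ^ m + a * (3 * - b - a) * a ^ m) =
          (2 ^ m * (-1) ^ h) * ((a * b) ^ h * (b * (3 * a + b) * b ^ m - a * (3 * b + a) * a ^ m))"
        unfolding m power_minus[of "a * b"] mult_minus_right by (simp add: algebra_simps)
      also have "[(2 ^ m * (-1) ^ h) * ((a * b) ^ h * (b * (3 * a + b) * b ^ m - a * (3 * b + a) * a ^ m)) =
          ((-1) ^ h * (-1) ^ h) * ((a * b) ^ h *
            (b * (3 * a + b) * Legendre b (int p) - a * (3 * b + a) * Legendre a (int p)))] (mod int p)"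
        by (intro cong_mult cong_diff cong_refl Leg two_power_half_odd[OF p h(1)])
      also have "(-1) ^ h * (-1) ^ h = (1 :: int)"
        by (simp flip: power_mult_distrib)
      also have "2 * (a + - b) * (a * - b) = 2 * (b - a) * (a * b)"
        by (simp add: algebra_simps)
      finally show "[2 * (b - a) * (a * b) * (\<Sum>k=0..p-1. catalan_int (2 * k) * ((a - b)\<^sup>2 * w1) ^ k) =
          (a * b) ^ h * (b * (3 * a + b) * Legendre b (int p) - a * (3 * b + a) * Legendre a (int p))] (mod int p)"
        by (simp add: q1_def)
    qed
    show "rat_cong p (\<Sum>k=0..p-1. of_nat ((4*k) choose (2*k)) * ((A + B) ^ (2*k) / (64 * A * B) ^ k))
        (L 2 * (A * B) ^ ((p + 1) div 4) / (4 * (B - A)) * ((3 * A - B) / A * L b - (3 * B - A) / B * L a))"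
      unfolding sum2 h(2)
    proof (rule rat_cong_sumI[OF p(1) D2 w2])
      show "\<not> int p dvd 4 * (b - a) * (a * b)"
        using p4 ba a b P by (simp only: prime_dvd_mult_iff) simp
      show "of_int (4 * (b - a) * (a * b)) *
            (L 2 * (A * B) ^ h / (4 * (B - A)) * ((3 * A - B) / A * L b - (3 * B - A) / B * L a)) =
          of_int (Legendre 2 (int p) * (a * b) ^ h *
            (b * (3 * a - b) * Legendre b (int p) - a * (3 * b - a) * Legendre a (int p)))"
        using nz by (simp add: L_def field_simps flip: A_def B_def)
      have "[4 * (b - a) * (a * b) * (\<Sum>k=0..p-1. int (central (2 * k)) * q2 ^ k) =
          2 ^ m * (a * b) ^ h * (b * (3 * a - b) * b ^ m - a * (3 * b - a) * a ^ m)] (mod int p)"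
        by (rule sum_central_odd[OF p a b ab q2 h(1)])
      also have "[2 ^ m * (a * b) ^ h * (b * (3 * a - b) * b ^ m - a * (3 * b - a) * a ^ m) =
          Legendre 2 (int p) * (a * b) ^ h *
            (b * (3 * a - b) * Legendre b (int p) - a * (3 * b - a) * Legendre a (int p))] (mod int p)"
        by (intro cong_mult cong_diff cong_refl Leg)
      finally show "[4 * (b - a) * (a * b) * (\<Sum>k=0..p-1. int (central (2 * k)) * ((a + b)\<^sup>2 * w2) ^ k) =
          Legendre 2 (int p) * (a * b) ^ h *
            (b * (3 * a - b) * Legendre b (int p) - a * (3 * b - a) * Legendre a (int p))] (mod int p)"
        by (simp add: q2_def)
    qed
  qed
qed

end
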